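(* For every integer $n\ge0$, $$2^n\mu_n(a,b,q/a,q/b;q) = \sum_{k=0}^{n} \left(\binom{n}{\frac{n-k}2}-\binom{n}{\frac{n-k}2-1}\right) \frac{1}{[k+1]_q} \sum_{\substack{|A|+|B|\le k \\ A+B\equiv k \bmod 2}} a^A b^B q^{\frac{k-A-B}2},$$ where the second sum is over all integers $A$ and $B$ such that $|A|+|B|\le k$ and $A+B\equiv k \bmod 2$. Thus $[n+1]_q!\, 2^n\mu_n(a,b,q/a,q/b;q)$ is a Laurent polynomial in $a$ and $b$ whose coefficients are positive polynomials in $q$ (i.e. polynomials in $q$ with nonnegative coefficients).
   Context: Let $a,b,c,d,q$ be indeterminates (generic parameters). The monic Askey-Wilson polynomials $P_n(x)=P_n(x;a,b,c,d;q)$ are defined by $P_{-1}=0$, $P_0=1$, $P_{n+1}=(x-b_n)P_n-\lambda_nP_{n-1}$, with $b_n=\frac12(a+a^{-1}-(A_n+C_n))$, $\lambda_n=\frac14A_{n-1}C_n$, where $$A_n=\frac{(1-abq^n)(1-acq^n)(1-adq^n)(1-abcdq^{n-1})}{a(1-abcdq^{2n-1})(1-abcdq^{2n})},\quad C_n=\frac{a(1-q^n)(1-bcq^{n-1})(1-bdq^{n-1})(1-cdq^{n-1})}{(1-abcdq^{2n-2})(1-abcdq^{2n-1})}$$ (for $n=0$ the common factor $1-abcdq^{-1}$ in $A_0$ is cancelled, and $C_0=0$). The moment $\mu_n(a,b,c,d;q)=L(x^n)$, where $L$ is the unique linear functional on polynomials in $x$ with $L(1)=1$ and $L(P_n)=0$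 for all $n\ge1$ (so that $L(P_mP_n)=0$ for $m\neq n$). It is a rational function of $a,b,c,d,q$, symmetric in $a,b,c,d$; here it is specialized at $c=q/a$, $d=q/b$. Notation: $[m]_q=(1-q^m)/(1-q)=1+q+\cdots+q^{m-1}$, $[m]_q!=[1]_q[2]_q\cdots[m]_q$. $\binom nr=0$ unless $r$ is an integer with $0\le r\le n$ (so only $k\equiv n\bmod 2$ contribute). *)

theory Defs
  imports
    "HOL-Computational_Algebra.Computational_Algebra"
    "HOL-Number_Theory.Cong"
begin

section \<open>Monic Askey--Wilson polynomials and their moments\<close>

text \<open>
  The case \<open>n = 0\<close> is \<open>A\<^sub>0\<close> after cancelling the common factor \<open>1 - abcd/q\<close>.
\<close>
definition aw_A :: "'k::field \<Rightarrow> 'k \<Rightarrow> 'k \<Rightarrow> 'k \<Rightarrow> 'k \<Rightarrow> nat \<Rightarrow> 'k" where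
  "aw_A a b c d q n =
     (if n = 0
      then (1 - a*b) * (1 - a*c) * (1 - a*d) / (a * (1 - a*b*c*d))
      else (1 - a*b*q^n) * (1 - a*c*q^n) * (1 - a*d*q^n) * (1 - a*b*c*d*q^(n-1))
           / (a * (1 - a*b*c*d*q^(2*n-1)) * (1 - a*b*c*d*q^(2*n))))"

definition aw_C :: "'k::field \<Rightarrow> 'k \<Rightarrow> 'k \<Rightarrow> 'k \<Rightarrow> 'k \<Rightarrow> nat \<Rightarrow> 'k" where
  "aw_C a b c d q n =
     (if n = 0 then 0
      else a * (1 - q^n) * (1 - b*c*q^(n-1)) * (1 - b*d*q^(n-1)) * (1 - c*d*q^(n-1))
           / ((1 - a*b*c*d*q^(2*n-2)) * (1 - a*b*c*d*q^(2*n-1))))"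

definition aw_b :: "'k::field \<Rightarrow> 'k \<Rightarrow> 'k \<Rightarrow> 'k \<Rightarrow> 'k \<Rightarrow> nat \<Rightarrow> 'k" where
  "aw_b a b c d q n = (1/2) * (a + inverse a - (aw_A a b c d q n + aw_C a b c d q n))"

text \<open>
  Only used for \<open>n \<ge> 1\<close>: the coefficient \<open>\<lambda>\<^sub>0\<close> multiplies \<open>P\<^sub>-\<^sub>1 = 0\<close>.
\<close>
definition aw_lambda :: "'k::field \<Rightarrow> 'k \<Rightarrow> 'k \<Rightarrow> 'k \<Rightarrow> 'k \<Rightarrow> nat \<Rightarrow> 'k" where
  "aw_lambda a b c d q n = (1/4) * aw_A a b c d q (n-1) * aw_C a b c d q n"

fun aw_poly :: "'k::field \<Rightarrow> 'k \<Rightarrow> 'k \<Rightarrow> 'k \<Rightarrow> 'k \<Rightarrow> nat \<Rightarrow> 'k poly" where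
  "aw_poly a b c d q 0 = 1"
| "aw_poly a b c d q (Suc 0) = [:- aw_b a b c d q 0, 1:]"
| "aw_poly a b c d q (Suc (Suc n)) =
     [:- aw_b a b c d q (Suc n), 1:] * aw_poly a b c d q (Suc n)
     - smult (aw_lambda a b c d q (Suc n)) (aw_poly a b c d q n)"

definition aw_functional ::
    "'k::field \<Rightarrow> 'k \<Rightarrow> 'k \<Rightarrow> 'k \<Rightarrow> 'k \<Rightarrow> 'k poly \<Rightarrow> 'k" where
  "aw_functional a b c d q =
     (THE L. Vector_Spaces.linear smult (*) L \<and> L 1 = 1 \<and> (\<forall>n\<ge>1. L (aw_poly a b c d q n) = 0))"

definition aw_moment :: "'k::field \<Rightarrow> 'k \<Rightarrow> 'k \<Rightarrow> 'k \<Rightarrow> 'k \<Rightarrow> nat \<Rightarrow> 'k" where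
  "aw_moment a b c d q n = aw_functional a b c d q (monom 1 n)"


section \<open>Binomial coefficients and \<open>q\<close>-numbers\<close>

text \<open>Zero unless \<open>r\<close> is an integer with \<open>0 \<le> r \<le> n\<close>.\<close>
definition binom :: "nat \<Rightarrow> rat \<Rightarrow> int" where
  "binom n r = (if r \<in> \<int> \<and> 0 \<le> r \<and> r \<le> of_nat n then int (n choose nat \<lfloor>r\<rfloor>) else 0)"

definition q_number :: "'k::field \<Rightarrow> nat \<Rightarrow> 'k" where
  "q_number q m = (1 - q^m) / (1 - q)"

definition q_fact :: "'k::field \<Rightarrow> nat \<Rightarrow> 'k" where
  "q_fact q m = (\<Prod>i=1..m. q_number q i)"


section \<open>The field of rational functions in the indeterminates \<open>a\<close>, \<open>b\<close>, \<open>q\<close>\<close>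

text \<open>
  The field of fractions of \<open>\<int>[q][b][a]\<close>, that is \<open>\<rat>(a,b,q)\<close>; the innermost polynomial
  variable is \<open>q\<close> and the outermost is \<open>a\<close>.  At the parameters \<open>(a, b, q/a, q/b)\<close>
  one has \<open>abcd = q\<^sup>2\<close>, so the denominators in the recurrence coefficients are nonzero
  in this field.
\<close>
type_synonym ratfun = "int poly poly poly fract"

definition var_a :: ratfun where "var_a = to_fract [:0, 1:]"
definition var_b :: ratfun where "var_b = to_fract [:[:0, 1:]:]"
definition var_q :: ratfun where "var_q = to_fract [:[:[:0, 1:]:]:]"

text \<open>
  Laurent polynomials in \<open>a\<close>, \<open>b\<close> whose coefficients are polynomials in \<open>q\<close>
  with nonnegative (integer) coefficients.
\<close>
definition positive_laurent :: "ratfun \<Rightarrow> bool" where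
  "positive_laurent f \<longleftrightarrow>
     (\<exists>S :: (int \<times> int) set. \<exists>p :: int \<Rightarrow> int \<Rightarrow> int poly.
        finite S \<and> (\<forall>A B i. 0 \<le> coeff (p A B) i) \<and>
        f = (\<Sum>(A, B)\<in>S. to_fract [:[:p A B:]:] * var_a powi A * var_b powi B))"

end

theory Submission
  imports Defs
begin

text \<open>
  Put \<open>x = (z + 1/z)/2\<close> and \<open>c = q/a\<close>, \<open>d = q/b\<close>.  In the basis \<open>\<phi>\<^sub>k(x) = (az, a/z; q)\<^sub>k\<close> the polynomial
  \<open>P\<^sub>n\<close> is a multiple of the usual basic hypergeometric sum, and the functional with
  \<open>L(\<phi>\<^sub>k) = (ab, aq/b; q)\<^sub>k (1 - q)/(1 - q\<^sup>k\<^sup>+\<^sup>1)\<close> kills \<open>P\<^sub>n\<close> for \<open>n \<ge> 1\<close> because the resulting sum telescopes.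

  The \<open>L(\<phi>\<^sub>k)\<close> say that \<open>L\<close> inverts the Askey--Wilson derivative \<open>D\<close>:
  \<open>L(D F)\<close> is a constant times the difference of \<open>F\<close> at two points, those belonging to \<open>z = b/q\<close> and \<open>z = a/q\<close>.
  As \<open>D\<close> maps the Chebyshev polynomial \<open>T\<^sub>k\<^sub>+\<^sub>1\<close> to a multiple of \<open>U\<^sub>k\<close>, this gives
  \<open>L(U\<^sub>k)\<close> as a product of two geometric sums divided by \<open>[k+1]\<close>, and that product is the sum over the lattice
  points of the diamond \<open>\<bar>A\<bar> + \<bar>B\<bar> \<le> k\<close>.  Finally \<open>(2x)\<^sup>n\<close> is expanded in the \<open>U\<^sub>k\<close>.
\<close>

section \<open>Linear functionals on polynomials\<close>

lemma linear_functional_iff: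
  fixes L :: "'k::field poly \<Rightarrow> 'k"
  shows "Vector_Spaces.linear smult (*) L \<longleftrightarrow>
    (\<forall>p r. L (p + r) = L p + L r) \<and> (\<forall>c p. L (smult c p) = c * L p)"
  unfolding Vector_Spaces.linear_def module_hom_def module_hom_axioms_def module_def vector_space_def
  by (auto simp: algebra_simps smult_add_right smult_add_left)

locale poly_functional =
  fixes L :: "'k::field poly \<Rightarrow> 'k"
  assumes add: "L (p + r) = L p + L r" and smult: "L (smult c p) = c * L p"
begin

lemma zero: "L 0 = 0"
  using smult[of 0 0] by simp

lemma sum: "L (\<Sum>i\<in>I. f i) = (\<Sum>i\<in>I. L (f i))"
  by (induction I rule: infinite_finite_induct) (auto simp: zero add)

end

text \<open>Subtracting a multiple of the basis element of the same degree lowers the degree, or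
  leaves 0 when the degree is already 0.\<close>

lemma degree_basis_induct [consumes 1, case_names zero basis add smult]:
  fixes B :: "nat \<Rightarrow> 'k::field poly"
  assumes B: "\<And>n. B n \<noteq> 0 \<and> degree (B n) = n"
    and zero: "P 0" and basis: "\<And>n. P (B n)"
    and add: "\<And>p r. P p \<Longrightarrow> P r \<Longrightarrow> P (p + r)"
    and smult: "\<And>c p. P p \<Longrightarrow> P (smult c p)"
  shows "P p"
proof (induction "degree p" arbitrary: p rule: less_induct)
  case less
  define c where "c = lead_coeff p / lead_coeff (B (degree p))"
  define r where "r = p - smult c (B (degree p))"
  have lc: "lead_coeff (B n) \<noteq> 0" for n by (metis B leading_coeff_0_iff)
  have p: "p = r + smult c (B (degree p))" by (simp add: r_def)
  have deg: "degree r \<le> degree p"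
    unfolding r_def by (rule degree_diff_le) (auto simp: B)
  have co: "coeff r (degree p) = 0"
    using lc[of "degree p"] B[of "degree p"] by (simp add: r_def c_def)
  have "P r"
  proof (cases "degree r < degree p")
    case True
    then show ?thesis by (rule less)
  next
    case False
    then have "lead_coeff r = 0" using deg co by simp
    then show ?thesis using zero by simp
  qed
  then show ?case by (subst p) (intro add smult basis)
qed

lemma functional_unique:
  assumes "\<And>n. B n \<noteq> 0 \<and> degree (B n) = n"
    and "poly_functional L" "poly_functional L'" and "\<And>n. L (B n) = L' (B n)"
  shows "L = L'"
proof
  interpret L: poly_functional L by fact
  interpret L': poly_functional L' by fact
  show "L p = L' p" for p
    using assms(1) by (induction p rule: degree_basis_induct)
      (auto simp: L.zero L'.zero assms L.add L'.add L.smult L'.smult)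
qed

text \<open>The prescribed values form a triangular system for the moments of \<open>L\<close>,
  solvable because leading coefficients are nonzero.\<close>

lemma functional_exists:
  fixes B :: "nat \<Rightarrow> 'k::field poly"
  assumes B: "\<And>n. B n \<noteq> 0 \<and> degree (B n) = n"
  obtains L where "poly_functional L" and "\<And>n. L (B n) = v n"
proof -
  \<comment> \<open>Solves the \<open>n\<close>-th equation for the \<open>n\<close>-th moment;
    \<open>wfrec\<close> supplies the earlier moments.\<close>
  define step where
    "step m n = (v n - (\<Sum>i<n. coeff (B n) i * m i)) / lead_coeff (B n)" for m :: "nat \<Rightarrow> 'k" and n
  define m where "m = wfrec less_than step"
  have m: "m n = step m n" for n
    unfolding m_def
    by (rule wfrec_fixpoint[THEN fun_cong])
      (auto simp: adm_wf_def step_def intro!: sum.cong)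
  define L where "L p = (\<Sum>i\<le>degree p. coeff p i * m i)" for p
  have L: "L p = (\<Sum>i\<le>N. coeff p i * m i)" if "degree p \<le> N" for p N
    unfolding L_def using that
    by (intro sum.mono_neutral_left) (auto simp: coeff_eq_0)
  have "poly_functional L"
  proof
    fix p r :: "'k poly" and c
    let ?N = "max (degree p) (degree r)"
    have "degree (p + r) \<le> ?N" by (rule degree_add_le_max)
    then show "L (p + r) = L p + L r"
      using L[of "p + r" ?N] L[of p ?N] L[of r ?N] by (simp add: sum.distrib algebra_simps)
    show "L (smult c p) = c * L p"
      using L[of "smult c p" "degree p"] by (simp add: L_def sum_distrib_left mult.assoc degree_smult_le)
  qed
  moreover have "L (B n) = v n" for n
  proof -
    have "lead_coeff (B n) \<noteq> 0" by (metis B leading_coeff_0_iff)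
    moreover have "degree (B n) = n" using B by simp
    ultimately show ?thesis
      unfolding L_def by (simp add: m[of n] step_def flip: lessThan_Suc_atMost)
  qed
  ultimately show thesis by (rule that)
qed

section \<open>The Askey--Wilson recurrence at \<open>c = q/a\<close>, \<open>d = q/b\<close>\<close>

lemma aw_poly_degree: "aw_poly a b c d q n \<noteq> 0 \<and> degree (aw_poly a b c d q n) = n"
proof (induction n rule: less_induct)
  case (less n)
  consider "n = 0" | "n = Suc 0" | m where "n = Suc (Suc m)" by (metis not0_implies_Suc)
  then show ?case
  proof cases
    case 3
    define p where "p = [:- aw_b a b c d q (Suc m), 1:] * aw_poly a b c d q (Suc m)"
    define r where "r = - smult (aw_lambda a b c d q (Suc m)) (aw_poly a b c d q m)"
    have n: "aw_poly a b c d q n = p + r" using 3 by (simp only: aw_poly.simps p_def r_def diff_conv_add_uminus)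
    have "degree p = n" unfolding p_def using less[of "Suc m"] 3 by (subst degree_mult_eq) auto
    moreover have "degree r < n"
      unfolding r_def using less[of m] 3 by (auto intro: le_less_trans[OF degree_smult_le])
    ultimately have "degree (aw_poly a b c d q n) = n"
      unfolding n by (simp add: degree_add_eq_left)
    then show ?thesis using 3 by (metis degree_0 nat.distinct(1))
  qed simp_all
qed

fun chebyshev_U :: "nat \<Rightarrow> 'k::field poly" where
  "chebyshev_U 0 = 1"
| "chebyshev_U (Suc 0) = [:0, 2:]"
| "chebyshev_U (Suc (Suc n)) = [:0, 2:] * chebyshev_U (Suc n) - chebyshev_U n"

text \<open>The inequalities keep all denominators nonzero: those of the recurrence coefficients,
  the symbols \<open>(ab; q)_k\<close> and \<open>(aq/b; q)_k\<close>, and, through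
  \<open>ab \<noteq> q\<close> and \<open>a \<noteq> b\<close> (the case \<open>n = 0\<close> of
  \<open>aqb\<close>), those of \<open>kappa\<close> and of the geometric sums.\<close>

locale aw_generic =
  fixes a b q :: "'k::field"
  assumes two: "(2::'k) \<noteq> 0" and a0: "a \<noteq> 0" and b0: "b \<noteq> 0" and q0: "q \<noteq> 0"
    and qpow: "n > 0 \<Longrightarrow> q ^ n \<noteq> 1"
    and abq: "a * b * q ^ n \<noteq> 1" and aqb: "a * q ^ n \<noteq> b" and ab: "a * b \<noteq> q"
begin

section \<open>Basic hypergeometric form of the polynomials\<close>

definition qpoch :: "'k \<Rightarrow> nat \<Rightarrow> 'k" where "qpoch x k = (\<Prod>i<k. 1 - x * q ^ i)"

text \<open>\<open>(q\<^sup>-\<^sup>n; q)\<^sub>k (q\<^sup>n\<^sup>+\<^sup>1; q)\<^sub>k\<close>, where \<open>q\<^sup>n\<^sup>+\<^sup>1 = abcd q\<^sup>n\<^sup>-\<^sup>1\<close>.\<close>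
definition aw_factor :: "nat \<Rightarrow> nat \<Rightarrow> 'k" where
  "aw_factor n k = (\<Prod>i<k. (1 - q ^ i / q ^ n) * (1 - q ^ (n + 1 + i)))"

text \<open>Coefficients of the 4phi3 series with lower parameters \<open>ab\<close>,
  \<open>ac = q\<close>, \<open>ad = aq/b\<close>; the square arises because \<open>ac = q\<close>
  repeats the usual \<open>(q; q)_k\<close>.\<close>

definition aw_coeff :: "nat \<Rightarrow> nat \<Rightarrow> 'k" where
  "aw_coeff n k = aw_factor n k * q ^ k / (qpoch (a * b) k * qpoch (a * q / b) k * (qpoch q k)\<^sup>2)"

definition phi :: "nat \<Rightarrow> 'k poly" where
  "phi k = (\<Prod>i<k. [:1 + a\<^sup>2 * q ^ (2 * i), - 2 * a * q ^ i:])"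

definition aw_phi :: "nat \<Rightarrow> 'k poly" where "aw_phi n = (\<Sum>k\<le>n. smult (aw_coeff n k) (phi k))"

abbreviation "A \<equiv> aw_A a b (q / a) (q / b) q"
abbreviation "C \<equiv> aw_C a b (q / a) (q / b) q"
abbreviation "P \<equiv> aw_poly a b (q / a) (q / b) q"

lemma qpoch_0 [simp]: "qpoch x 0 = 1" and qpoch_Suc: "qpoch x (Suc k) = qpoch x k * (1 - x * q ^ k)"
  by (simp_all add: qpoch_def)

lemma aw_factor_0 [simp]: "aw_factor n 0 = 1"
  and aw_factor_Suc: "aw_factor n (Suc k) = aw_factor n k * ((1 - q ^ k / q ^ n) * (1 - q ^ (n + 1 + k)))"
  by (simp_all add: aw_factor_def)

lemma aw_coeff_0 [simp]: "aw_coeff n 0 = 1"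
  by (simp add: aw_coeff_def)

lemma phi_0 [simp]: "phi 0 = 1"
  and phi_Suc: "phi (Suc k) = phi k * [:1 + a\<^sup>2 * q ^ (2 * k), - 2 * a * q ^ k:]"
  by (simp_all add: phi_def)

lemma one_minus_qpow: "n > 0 \<Longrightarrow> 1 - q ^ n \<noteq> 0"
  using qpow[of n] by auto

lemma qpoch_nonzero: "qpoch (a * b) k \<noteq> 0" "qpoch (a * q / b) k \<noteq> 0" "qpoch q k \<noteq> 0"
proof -
  have "1 - a * b * q ^ i \<noteq> 0" for i using abq[of i] by auto
  then show "qpoch (a * b) k \<noteq> 0" by (simp add: qpoch_def)
  have "1 - a * q / b * q ^ i \<noteq> 0" for i using aqb[of "Suc i"] b0 by (auto simp: field_simps)
  then show "qpoch (a * q / b) k \<noteq> 0" unfolding qpoch_def prod_zero_iff[OF finite_lessThan] by blast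
  have "1 - q * q ^ i \<noteq> 0" for i using one_minus_qpow[of "Suc i"] by simp
  then show "qpoch q k \<noteq> 0" by (simp add: qpoch_def)
qed

text \<open>The factor of \<open>(q^-n; q)_k\<close> with index \<open>n\<close> vanishes, so the
  series terminates.\<close>

lemma aw_coeff_eq_0: "k > n \<Longrightarrow> aw_coeff n k = 0"
  using q0 by (auto simp: aw_coeff_def aw_factor_def intro!: prod_zero bexI[of _ n])

text \<open>Raising \<open>n\<close> shifts the two Pochhammer symbols in opposite directions, so
  only boundary factors change. Together with the next lemma this lets the neighbours of degree
  \<open>n\<close> be expressed through \<open>aw_factor n k\<close>.\<close>

lemma aw_factor_Suc_left:
  "aw_factor (Suc n) (Suc k) * (1 - q ^ Suc n) =
   aw_factor n k * (1 - 1 / q ^ Suc n) * (1 - q ^ (n + k + 1)) * (1 - q ^ (n + k + 2))"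
proof (induction k)
  case 0
  show ?case by (simp add: aw_factor_Suc)
next
  case (Suc k)
  have "aw_factor (Suc n) (Suc (Suc k)) * (1 - q ^ Suc n) =
    (aw_factor (Suc n) (Suc k) * (1 - q ^ Suc n)) * ((1 - q ^ k / q ^ n) * (1 - q ^ (n + k + 3)))"
    using q0 by (simp add: aw_factor_Suc numeral_3_eq_3)
  also have "\<dots> = aw_factor n (Suc k) * (1 - 1 / q ^ Suc n) * (1 - q ^ (n + Suc k + 1)) * (1 - q ^ (n + Suc k + 2))"
    unfolding Suc by (simp add: aw_factor_Suc numeral_3_eq_3)
  finally show ?case .
qed

lemma aw_factor_Suc_right:
  "aw_factor n (Suc k) * (1 - 1 / q ^ Suc n) =
   aw_factor (Suc n) k * (1 - q ^ Suc n) * (1 - q ^ k / q ^ Suc n) * (1 - q ^ Suc k / q ^ Suc n)"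
proof (induction k)
  case 0
  show ?case using q0 by (simp add: aw_factor_Suc)
next
  case (Suc k)
  have "aw_factor n (Suc (Suc k)) * (1 - 1 / q ^ Suc n) =
    (aw_factor n (Suc k) * (1 - 1 / q ^ Suc n)) * ((1 - q ^ Suc k / q ^ n) * (1 - q ^ (n + k + 2)))"
    by (simp add: aw_factor_Suc)
  also have "\<dots> = aw_factor (Suc n) (Suc k) * (1 - q ^ Suc n) * (1 - q ^ Suc k / q ^ Suc n) * (1 - q ^ Suc (Suc k) / q ^ Suc n)"
    unfolding Suc using q0 by (simp add: aw_factor_Suc)
  finally show ?case .
qed

text \<open>Since \<open>ac = q\<close> and \<open>abcd = q^2\<close>, the factors
  \<open>1 - acq^n\<close> and \<open>1 - abcdq^(n-1)\<close> coincide. The cancelled case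
  \<open>n = 0\<close> fits the same formula.\<close>

lemma A_eq:
  "A n = (1 - a * b * q ^ n) * (1 - q ^ Suc n)\<^sup>2 * (1 - a * q / b * q ^ n) /
     (a * (1 - q ^ (2 * n + 1)) * (1 - q ^ (2 * n + 2)))"
proof (cases n)
  case 0
  then show ?thesis using a0 b0 one_minus_qpow[of 1]
    by (simp add: aw_A_def power2_eq_square)
next
  case (Suc m)
  have "a * b * (q / a) * (q / b) = q * q" using a0 b0 by simp
  then show ?thesis using Suc a0 by (simp add: aw_A_def power2_eq_square mult_ac)
qed

lemma C_eq:
  "C n = (if n = 0 then 0 else a * (1 - q ^ n)\<^sup>2 * (1 - b / (a * q) * q ^ Suc n) * (1 - q ^ Suc n / (a * b)) /
     ((1 - q ^ (2 * n)) * (1 - q ^ (2 * n + 1))))"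
proof (cases n)
  case 0
  then show ?thesis by (simp add: aw_C_def)
next
  case (Suc m)
  have "a * b * (q / a) * (q / b) = q * q" using a0 b0 by simp
  then show ?thesis using Suc b0 q0 by (simp add: aw_C_def power2_eq_square mult_ac)
qed

text \<open>The difference produces \<open>1 + q^(n+1)\<close>, which cancels against a factor of
  \<open>1 - q^(2n+2)\<close> in \<open>A n\<close>; \<open>1 - q^(2n+1)\<close> survives, as it
  does in \<open>C_diff\<close>.\<close>

lemma A_diff:
  assumes N_def: "N = q ^ n" and K_def: "K = q ^ k"
  shows "A n * (aw_factor (Suc n) (Suc k) - aw_factor n (Suc k)) =
   - ((1 - q * K) * ((1 - a * b * N) * (1 - a * q / b * N) * (1 - q * N) * (1 - q * N * K)) /
     (a * (q * N) * (1 - q * N\<^sup>2))) * aw_factor n k"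
proof -
  have N: "N \<noteq> 0" using q0 by (simp add: N_def)
  have nz: "1 - q * N \<noteq> 0" "1 - q * N\<^sup>2 \<noteq> 0" "1 - q * q * N\<^sup>2 \<noteq> 0"
    using one_minus_qpow[of "Suc n"] one_minus_qpow[of "2 * n + 1"] one_minus_qpow[of "2 * n + 2"]
    by (simp_all add: N_def power_mult mult.commute[of 2] power2_eq_square mult.assoc)
  have fac: "1 - q * q * N\<^sup>2 = (1 - q * N) * (1 + q * N)"
    by (simp add: algebra_simps power2_eq_square)
  have nz2: "1 + q * N \<noteq> 0" using nz fac by auto
  have "aw_factor (Suc n) (Suc k) * (1 - q * N) = aw_factor n k * (1 - 1 / (q * N)) * (1 - q * N * K) * (1 - q * q * N * K)"
    using aw_factor_Suc_left[of n k] by (simp add: N_def K_def power_add mult_ac)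
  then have l: "aw_factor (Suc n) (Suc k) = aw_factor n k * (1 - 1 / (q * N)) * (1 - q * N * K) * (1 - q * q * N * K) / (1 - q * N)"
    using nz by (simp add: field_simps)
  have r: "aw_factor n (Suc k) = aw_factor n k * ((1 - K / N) * (1 - q * N * K))"
    by (simp add: aw_factor_Suc N_def K_def power_add mult_ac)
  have d: "aw_factor (Suc n) (Suc k) - aw_factor n (Suc k) =
     - (aw_factor n k * (1 - q * N * K) * (1 - q * K) * (1 + q * N) / (q * N))"
    unfolding l r using nz N q0 by (simp add: divide_simps) (simp add: algebra_simps power2_eq_square)
  have A: "A n = (1 - a * b * N) * (1 - q * N) * (1 - a * q / b * N) / (a * (1 - q * N\<^sup>2) * (1 + q * N))"
  proof -
    have "A n = (1 - a * b * N) * (1 - q * N)\<^sup>2 * (1 - a * q / b * N) / (a * (1 - q * N\<^sup>2) * (1 - q * q * N\<^sup>2))"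
      unfolding A_eq by (simp add: N_def power_mult mult.commute[of 2] power2_eq_square mult.assoc)
    then show ?thesis unfolding fac power2_eq_square[of "1 - q * N"] using nz by (simp add: mult.assoc)
  qed
  show ?thesis
    unfolding d A using nz2 by (simp add: mult_ac)
qed

lemma C_diff:
  assumes N_def: "N = q ^ n" and K_def: "K = q ^ k"
  shows "C n * (aw_factor n (Suc k) - aw_factor (n - 1) (Suc k)) =
     (1 - q * K) * a * (1 - N) * (1 - b / a * N) * (1 - q * N / (a * b)) * (1 - K / N) / (1 - q * N\<^sup>2) * aw_factor n k"
\<comment> \<open>At \<open>n = 0\<close> the truncated \<open>n - 1\<close> does no harm because
  \<open>C 0 = 0\<close>.\<close>
proof (cases n)
  case 0
  then show ?thesis by (simp add: C_eq N_def)
next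
  case (Suc m)
  then have n: "n > 0" by simp
  have N: "N \<noteq> 0" using q0 by (simp add: N_def)
  have nz: "1 - N \<noteq> 0" "1 - q * N\<^sup>2 \<noteq> 0" "1 - N\<^sup>2 \<noteq> 0"
    using one_minus_qpow[of n] one_minus_qpow[of "2 * n + 1"] one_minus_qpow[of "2 * n"] n
    by (simp_all add: N_def power_mult mult.commute[of 2])
  have fac: "1 - N\<^sup>2 = (1 - N) * (1 + N)"
    by (simp add: algebra_simps power2_eq_square)
  have nz2: "1 + N \<noteq> 0" using nz fac by auto
  have "aw_factor m (Suc k) * (1 - 1 / N) = aw_factor n k * (1 - N) * (1 - K / N) * (1 - q * K / N)"
    using aw_factor_Suc_right[of m k] Suc by (simp add: N_def K_def)
  moreover have "aw_factor m (Suc k) * (1 - 1 / N) = - aw_factor m (Suc k) / N * (1 - N)"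
    using N by (simp add: field_simps)
  ultimately have "- aw_factor m (Suc k) / N * (1 - N) = aw_factor n k * (1 - K / N) * (1 - q * K / N) * (1 - N)"
    by (simp add: mult_ac)
  then have "- aw_factor m (Suc k) / N = aw_factor n k * (1 - K / N) * (1 - q * K / N)"
    using nz(1) by (rule mult_right_cancel[THEN iffD1, rotated])
  then have "aw_factor m (Suc k) = - N * (aw_factor n k * (1 - K / N) * (1 - q * K / N))"
    using N by (simp add: field_simps)
  then have l: "aw_factor (n - 1) (Suc k) = - N * aw_factor n k * (1 - K / N) * (1 - q * K / N)"
    using Suc by (simp add: mult.assoc)
  have r: "aw_factor n (Suc k) = aw_factor n k * ((1 - K / N) * (1 - q * N * K))"
    by (simp add: aw_factor_Suc N_def K_def power_add mult_ac)
  have d: "aw_factor n (Suc k) - aw_factor (n - 1) (Suc k) = aw_factor n k * (1 - K / N) * (1 - q * K) * (1 + N)"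
    unfolding l r using N by (simp add: divide_simps) (simp add: algebra_simps power2_eq_square)
  have C: "C n = a * (1 - N) * (1 - b / a * N) * (1 - q * N / (a * b)) / ((1 + N) * (1 - q * N\<^sup>2))"
  proof -
    have "C n = a * (1 - N)\<^sup>2 * (1 - b / a * N) * (1 - q * N / (a * b)) / ((1 - N\<^sup>2) * (1 - q * N\<^sup>2))"
      unfolding C_eq using n q0 by (simp add: N_def power_mult mult.commute[of 2] power2_eq_square mult.assoc)
    then show ?thesis unfolding fac power2_eq_square[of "1 - N"] using nz by (simp add: mult.assoc)
  qed
  show ?thesis
    unfolding d C using nz2 by (simp add: mult_ac)
qed

text \<open>The three-term recurrence for \<open>aw_coeff\<close>, cleared of denominators, with \<open>N = q\<^sup>n\<close>, \<open>K = q\<^sup>k\<close>.\<close>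
lemma recurrence_identity:
  fixes N K d :: 'k
  assumes bd: "b * d = q"
  shows "K * (1 - a * b * N) * (1 - a * d * N) * (1 - q * N) * (1 - q * N * K)
      + q * K * (1 - N) * (a - b * N) * (a - d * N) * (N - K) =
    (1 - q * N\<^sup>2) * (N * (1 - a * b * K) * (1 - a * d * K) * (1 - q * K)
      - (1 - a\<^sup>2 * q * K) * (N - K) * (1 - q * N * K))"
  unfolding bd[symmetric] by (simp add: algebra_simps power2_eq_square)

text \<open>Compares coefficients of \<open>phi (Suc k)\<close> in the recurrence for
  \<open>aw_phi\<close>. With \<open>aw_factor n k\<close> factored out, it reduces to
  \<open>recurrence_identity\<close>.\<close>

lemma aw_coeff_recurrence:
  "- A n * (aw_coeff (Suc n) (Suc k) - aw_coeff n (Suc k)) + C n * (aw_coeff n (Suc k) - aw_coeff (n - 1) (Suc k)) =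
   (a + 1 / a - a * q ^ Suc k - 1 / (a * q ^ Suc k)) * aw_coeff n (Suc k) + aw_coeff n k / (a * q ^ k)"
proof -
  define N K d where N_def: "N = q ^ n" and K_def: "K = q ^ k" and d_def: "d = q / b"
  have NK: "N \<noteq> 0" "K \<noteq> 0" using q0 by (simp_all add: N_def K_def)
  have nz: "1 - q * N\<^sup>2 \<noteq> 0"
    using one_minus_qpow[of "2 * n + 1"] by (simp add: N_def power_mult mult.commute[of 2])
  have bd: "b * d = q" using b0 by (simp add: d_def)
  have d0: "d \<noteq> 0" using bd q0 by auto
  \<comment> \<open>The part of the coefficient at \<open>Suc k\<close> that does not depend on the
    degree.\<close>
  define D where "D = q ^ Suc k / (qpoch (a * b) (Suc k) * qpoch (a * q / b) (Suc k) * (qpoch q (Suc k))\<^sup>2)"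
  have t1: "aw_coeff m (Suc k) = aw_factor m (Suc k) * D" for m
    by (simp add: aw_coeff_def D_def)
  have t2: "aw_coeff n k = aw_factor n k * D * (1 - a * b * K) * (1 - a * d * K) * (1 - q * K)\<^sup>2 / q"
  proof -
    have "1 - a * b * K \<noteq> 0" "1 - a * d * K \<noteq> 0" "1 - q * K \<noteq> 0"
      using qpoch_nonzero[of "Suc k"] by (simp_all add: qpoch_Suc K_def d_def)
    moreover have "a * q / b = a * d" by (simp add: d_def)
    ultimately show ?thesis using qpoch_nonzero[of k] q0
      by (simp add: aw_coeff_def D_def qpoch_Suc K_def[symmetric] power_mult_distrib)
  qed
  have s1: "aw_factor n (Suc k) = aw_factor n k * ((1 - K / N) * (1 - q * N * K))"
    by (simp add: aw_factor_Suc N_def K_def power_add mult_ac)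
  have Ad: "A n * (aw_factor (Suc n) (Suc k) - aw_factor n (Suc k)) =
     - ((1 - q * K) * ((1 - a * b * N) * (1 - a * d * N) * (1 - q * N) * (1 - q * N * K)) /
       (a * (q * N) * (1 - q * N\<^sup>2))) * aw_factor n k"
    unfolding A_diff[OF N_def K_def] by (simp add: d_def)
  have Cd: "C n * (aw_factor n (Suc k) - aw_factor (n - 1) (Suc k)) =
     (1 - q * K) * ((1 - N) * (a - b * N) * (a - d * N) * (N - K)) / (a * N * (1 - q * N\<^sup>2)) * aw_factor n k"
  proof -
    have e: "1 - b / a * N = (a - b * N) / a" "1 - q * N / (a * b) = (a - d * N) / a" "1 - K / N = (N - K) / N"
      using a0 b0 NK by (simp_all add: d_def field_simps)
    note C_diff[OF N_def K_def, unfolded e]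
    also have "(1 - q * K) * a * (1 - N) * ((a - b * N) / a) * ((a - d * N) / a) * ((N - K) / N) / (1 - q * N\<^sup>2) * aw_factor n k = (1 - q * K) * ((1 - N) * (a - b * N) * (a - d * N) * (N - K)) / (a * N * (1 - q * N\<^sup>2)) * aw_factor n k"
      using a0 by (simp add: mult_ac)
    finally show ?thesis .
  qed
  have "- A n * (aw_coeff (Suc n) (Suc k) - aw_coeff n (Suc k)) + C n * (aw_coeff n (Suc k) - aw_coeff (n - 1) (Suc k)) =
    D * (C n * (aw_factor n (Suc k) - aw_factor (n - 1) (Suc k)) - A n * (aw_factor (Suc n) (Suc k) - aw_factor n (Suc k)))"
    unfolding t1 by (simp add: algebra_simps)
  also have "\<dots> = D * aw_factor n k * (1 - q * K) / (a * q * N * K * (1 - q * N\<^sup>2)) *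
     (K * (1 - a * b * N) * (1 - a * d * N) * (1 - q * N) * (1 - q * N * K)
      + q * K * (1 - N) * (a - b * N) * (a - d * N) * (N - K))"
    unfolding Ad Cd using nz NK a0 q0
    by (simp add: distrib_left mult_ac)
  also have "\<dots> = D * aw_factor n k * (1 - q * K) / (a * q * N * K) *
     (N * (1 - a * b * K) * (1 - a * d * K) * (1 - q * K) - (1 - a\<^sup>2 * q * K) * (N - K) * (1 - q * N * K))"
    unfolding recurrence_identity[OF bd] using nz by (simp add: mult.assoc)
  also have "\<dots> = aw_factor n k * D * (1 - a * b * K) * (1 - a * d * K) * (1 - q * K)\<^sup>2 / q / (a * K)
     - (1 - q * K) * (1 - a\<^sup>2 * q * K) / (a * q * K) * (aw_factor n k * ((1 - K / N) * (1 - q * N * K)) * D)"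
    using NK a0 q0
    by (simp add: diff_divide_distrib right_diff_distrib power2_eq_square) (simp add: field_simps)
  also have "(1 - q * K) * (1 - a\<^sup>2 * q * K) / (a * q * K) = - (a + 1 / a - a * (q * K) - 1 / (a * (q * K)))"
    using NK a0 q0 by (simp add: divide_simps) (simp add: algebra_simps power2_eq_square)
  finally show ?thesis
    unfolding t2 t1 s1 by (simp add: K_def algebra_simps)
qed

section \<open>The three-term recurrence in the basis \<open>phi\<close>\<close>

lemma phi_degree: "phi k \<noteq> 0 \<and> degree (phi k) = k"
proof (induction k)
  case 0
  show ?case by simp
next
  case (Suc k)
  define l where "l = [:1 + a\<^sup>2 * q ^ (2 * k), - 2 * a * q ^ k:]"
  have "l \<noteq> 0" "degree l = 1" using two a0 q0 by (simp_all add: l_def)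
  then show ?case using Suc unfolding phi_Suc l_def[symmetric] by (simp add: degree_mult_eq)
qed

text \<open>The last factor of \<open>phi (Suc k)\<close> vanishes at
  \<open>2x = a q^k + 1/(a q^k)\<close>; the linear polynomial is its value there plus a multiple of
  that factor.\<close>

lemma linear_mult_phi:
  "[:a + 1 / a, - 2:] * phi k =
   smult (a + 1 / a - a * q ^ k - 1 / (a * q ^ k)) (phi k) + smult (1 / (a * q ^ k)) (phi (Suc k))"
proof -
  have "smult (1 / (a * q ^ k)) [:1 + a\<^sup>2 * q ^ (2 * k), - 2 * a * q ^ k:] = [:1 / (a * q ^ k) + a * q ^ k, - 2:]"
    using a0 q0 unfolding power_even_eq by (simp add: field_simps power2_eq_square)
  then have "smult (1 / (a * q ^ k)) (phi (Suc k)) = phi k * [:1 / (a * q ^ k) + a * q ^ k, - 2:]"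
    unfolding phi_Suc by (metis mult_smult_right)
  also have "smult (a + 1 / a - a * q ^ k - 1 / (a * q ^ k)) (phi k) + \<dots> =
      phi k * ([:a + 1 / a - a * q ^ k - 1 / (a * q ^ k):] + [:1 / (a * q ^ k) + a * q ^ k, - 2:])"
    unfolding distrib_left by (simp del: mult_pCons_right add: mult_pCons_right[of _ _ 0])
  also have "[:a + 1 / a - a * q ^ k - 1 / (a * q ^ k):] + [:1 / (a * q ^ k) + a * q ^ k, - 2:] = [:a + 1 / a, - 2:]"
    by simp
  finally show ?thesis by (simp only: mult.commute)
qed

lemma aw_phi_extend: "n \<le> M \<Longrightarrow> aw_phi n = (\<Sum>k\<le>M. smult (aw_coeff n k) (phi k))"
  unfolding aw_phi_def by (intro sum.mono_neutral_left) (auto simp: aw_coeff_eq_0)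

lemma aw_phi_recurrence:
  "[:a + 1 / a, - 2:] * aw_phi n =
   smult (- A n) (aw_phi (Suc n) - aw_phi n) + smult (C n) (aw_phi n - aw_phi (n - 1))"
proof -
  define e where "e k = a + 1 / a - a * q ^ k - 1 / (a * q ^ k)" for k
  define w where "w k = - A n * (aw_coeff (Suc n) k - aw_coeff n k) + C n * (aw_coeff n k - aw_coeff (n - 1) k)" for k
  have "smult (- A n) (aw_phi (Suc n) - aw_phi n) + smult (C n) (aw_phi n - aw_phi (n - 1)) =
    (\<Sum>k\<le>Suc n. smult (w k) (phi k))"
  proof -
    have e: "aw_phi (Suc n) = (\<Sum>k\<le>Suc n. smult (aw_coeff (Suc n) k) (phi k))"
      "aw_phi n = (\<Sum>k\<le>Suc n. smult (aw_coeff n k) (phi k))"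
      "aw_phi (n - 1) = (\<Sum>k\<le>Suc n. smult (aw_coeff (n - 1) k) (phi k))"
      by (rule aw_phi_extend, simp)+
    have sm: "smult c (sum f I) = (\<Sum>i\<in>I. smult c (f i))" for c :: 'k and f and I :: "nat set"
      using sum_distrib_left[of "[:c:]" f I] by simp
    show ?thesis
      unfolding e sum_subtractf[symmetric] sm sum.distrib[symmetric]
      by (intro sum.cong refl) (simp add: w_def smult_diff_left smult_add_left smult_diff_right algebra_simps)
  qed
  \<comment> \<open>All coefficients at \<open>k = 0\<close> are 1, so
    \<open>w 0 = 0\<close>.\<close>
  also have "\<dots> = (\<Sum>k\<le>n. smult (w (Suc k)) (phi (Suc k)))"
    by (subst sum.atMost_Suc_shift) (simp add: w_def)
  also have "\<dots> = (\<Sum>k\<le>n. smult (e (Suc k) * aw_coeff n (Suc k)) (phi (Suc k))) +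
      (\<Sum>k\<le>n. smult (aw_coeff n k / (a * q ^ k)) (phi (Suc k)))"
    unfolding w_def aw_coeff_recurrence e_def[symmetric] by (simp add: smult_add_left sum.distrib)
  \<comment> \<open>The term \<open>k = 0\<close> is free since \<open>e 0 = 0\<close>; the next
    step drops the top term, where \<open>aw_coeff n (Suc n) = 0\<close>.\<close>
  also have "(\<Sum>k\<le>n. smult (e (Suc k) * aw_coeff n (Suc k)) (phi (Suc k))) =
      (\<Sum>k\<le>Suc n. smult (e k * aw_coeff n k) (phi k))"
    unfolding sum.atMost_Suc_shift by (simp add: e_def)
  also have "\<dots> = (\<Sum>k\<le>n. smult (e k * aw_coeff n k) (phi k))"
    by (simp add: aw_coeff_eq_0)
  also have "\<dots> + (\<Sum>k\<le>n. smult (aw_coeff n k / (a * q ^ k)) (phi (Suc k))) = [:a + 1 / a, - 2:] * aw_phi n"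
    unfolding aw_phi_def sum_distrib_left mult_smult_right linear_mult_phi e_def
    by (simp add: smult_add_right sum.distrib mult.commute)
  finally show ?thesis by simp
qed

lemma aw_phi_step:
  "smult (A n / 2) (aw_phi (Suc n)) =
   [:- aw_b a b (q / a) (q / b) q n, 1:] * aw_phi n - smult (C n / 2) (aw_phi (n - 1))"
proof -
  have b: "[:- aw_b a b (q / a) (q / b) q n, 1:] = smult (1 / 2) ([:A n + C n:] - [:a + 1 / a, - 2:])"
    using two by (simp add: aw_b_def inverse_eq_divide field_simps)
  have "[:- aw_b a b (q / a) (q / b) q n, 1:] * aw_phi n =
    smult (1 / 2) (smult (A n + C n) (aw_phi n) - [:a + 1 / a, - 2:] * aw_phi n)"
    unfolding b mult_smult_left left_diff_distrib by simp
  also have "\<dots> = smult (1 / 2) (smult (A n) (aw_phi (Suc n)) + smult (C n) (aw_phi (n - 1)))"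
    unfolding aw_phi_recurrence by (simp add: smult_diff_right smult_add_left)
  finally show ?thesis by (simp add: smult_add_right)
qed

text \<open>By \<open>aw_phi_step\<close> the normalising factor changes by \<open>A n / 2\<close>
  at each degree. The three-term recurrence calls for an induction over two consecutive
  degrees.\<close>

lemma P_eq_aw_phi:
  "P n = smult (\<Prod>i<n. A i / 2) (aw_phi n) \<and> P (Suc n) = smult (\<Prod>i<Suc n. A i / 2) (aw_phi (Suc n))"
proof (induction n)
  case 0
  have "aw_phi 0 = 1" by (simp add: aw_phi_def)
  moreover have "C 0 = 0" by (simp add: C_eq)
  ultimately show ?case using aw_phi_step[of 0] by simp
next
  case (Suc n)
  let ?k = "\<Prod>i<Suc n. A i / 2"
  let ?l = "[:- aw_b a b (q / a) (q / b) q (Suc n), 1:]"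
  have four: "1 / (4::'k) = 1 / 2 * (1 / 2)" by simp
  have la: "aw_lambda a b (q / a) (q / b) q (Suc n) * (\<Prod>i<n. A i / 2) = ?k * (C (Suc n) / 2)"
    unfolding aw_lambda_def four by simp
  have "P (Suc (Suc n)) = ?l * P (Suc n) - smult (aw_lambda a b (q / a) (q / b) q (Suc n)) (P n)"
    by (rule aw_poly.simps)
  also have "\<dots> = smult ?k (?l * aw_phi (Suc n) - smult (C (Suc n) / 2) (aw_phi n))"
    unfolding Suc[THEN conjunct1] Suc[THEN conjunct2] mult_smult_right smult_smult la smult_diff_right ..
  also have "\<dots> = smult (\<Prod>i<Suc (Suc n). A i / 2) (aw_phi (Suc (Suc n)))"
    unfolding prod.lessThan_Suc[of _ "Suc n"] smult_smult[symmetric] aw_phi_step by simp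
  finally show ?case using Suc by (intro conjI) (rule conjunct2)
qed

text \<open>The general value \<open>(ab, ac, ad; q)_k / (abcd; q)_k\<close> at
  \<open>ac = q\<close>, \<open>abcd = q^2\<close>, where \<open>(q; q)_k / (q^2; q)_k\<close>
  collapses.\<close>

definition phi_moment :: "nat \<Rightarrow> 'k" where
  "phi_moment k = qpoch (a * b) k * qpoch (a * q / b) k * (1 - q) / (1 - q ^ Suc k)"

text \<open>Induction on \<open>m\<close>; \<open>n > 0\<close> makes \<open>1 - 1/q^n\<close>
  nonzero.\<close>

lemma aw_factor_telescope:
  assumes "n > 0"
  shows "(\<Sum>k\<le>m. aw_factor n k * q ^ k / ((qpoch q k)\<^sup>2 * (1 - q ^ Suc k))) =
    aw_factor n (Suc m) / ((1 - 1 / q ^ n) * (1 - q ^ Suc n) * ((qpoch q m)\<^sup>2 * (1 - q ^ Suc m)))"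
proof -
  define E where "E = (1 - 1 / q ^ n) * (1 - q ^ Suc n)"
  have "1 - 1 / q ^ n \<noteq> 0" using qpow[OF assms] q0 by auto
  then have E: "E \<noteq> 0" using one_minus_qpow[of "Suc n"] by (simp add: E_def)
  show ?thesis unfolding E_def[symmetric]
  proof (induction m)
    case 0
    then show ?case using E by (simp add: aw_factor_Suc E_def)
  next
    case (Suc m)
    define M N Q where M_def: "M = q ^ m" and N_def: "N = q ^ n" and "Q = (qpoch q m)\<^sup>2"
    have nz: "N \<noteq> 0" "Q \<noteq> 0" "1 - q * M \<noteq> 0" "1 - q * q * M \<noteq> 0"
      using q0 qpoch_nonzero(3)[of m] one_minus_qpow[of "Suc m"] one_minus_qpow[of "Suc (Suc m)"]
      by (simp_all add: M_def N_def Q_def mult.assoc)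
    have E': "E = (1 - 1 / N) * (1 - q * N)" by (simp add: E_def N_def)
    \<comment> \<open>Over the common denominator the numerator becomes the two new factors of
      \<open>aw_factor n (Suc (Suc m))\<close>.\<close>
    have key: "(1 - q * M) * (1 - q * q * M) + q * M * E = (1 - q * M / N) * (1 - q * q * M * N)"
      unfolding E' using nz by (simp add: field_simps)
    have "(\<Sum>k\<le>Suc m. aw_factor n k * q ^ k / ((qpoch q k)\<^sup>2 * (1 - q ^ Suc k))) =
      aw_factor n (Suc m) / (E * (Q * (1 - q * M))) + aw_factor n (Suc m) * (q * M) / (Q * (1 - q * M)\<^sup>2 * (1 - q * q * M))"
      using Suc by (simp add: qpoch_Suc M_def Q_def power_mult_distrib mult.assoc)
    also have "\<dots> = aw_factor n (Suc m) * ((1 - q * M) * (1 - q * q * M) + q * M * E) /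
      (E * (Q * (1 - q * M)\<^sup>2 * (1 - q * q * M)))"
      using nz E by (simp add: divide_simps) (simp add: algebra_simps power2_eq_square)
    also have "\<dots> = aw_factor n (Suc (Suc m)) / (E * ((qpoch q (Suc m))\<^sup>2 * (1 - q ^ Suc (Suc m))))"
      unfolding key by (simp add: aw_factor_Suc[of n "Suc m"] qpoch_Suc M_def N_def Q_def power_mult_distrib mult.assoc
          power_add mult.left_commute)
    finally show ?case .
  qed
qed

text \<open>The symbols \<open>(ab; q)_k\<close> and \<open>(aq/b; q)_k\<close> cancel, and the
  closed form of the remaining sum contains \<open>aw_factor n (Suc n) = 0\<close>.\<close>

lemma sum_aw_coeff_phi_moment:
  assumes "n > 0"
  shows "(\<Sum>k\<le>n. aw_coeff n k * phi_moment k) = 0"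
proof -
  have "(\<Sum>k\<le>n. aw_coeff n k * phi_moment k) = (1 - q) * (\<Sum>k\<le>n. aw_factor n k * q ^ k / ((qpoch q k)\<^sup>2 * (1 - q ^ Suc k)))"
    unfolding sum_distrib_left using qpoch_nonzero by (intro sum.cong) (simp_all add: aw_coeff_def phi_moment_def mult_ac)
  also have "aw_factor n (Suc n) = 0" using q0 by (simp add: aw_factor_Suc)
  then have "(\<Sum>k\<le>n. aw_factor n k * q ^ k / ((qpoch q k)\<^sup>2 * (1 - q ^ Suc k))) = 0"
    unfolding aw_factor_telescope[OF assms] by simp
  finally show ?thesis by simp
qed

section \<open>The functional and the Askey--Wilson derivative\<close>

text \<open>
  \<open>askey_wilson_derivative F f\<close> says that \<open>f\<close> is a multiple of the Askey--Wilson derivative of \<open>F\<close>.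
  To avoid the square root of \<open>q\<close>, the polynomial \<open>F\<close> is taken in the
  variable \<open>z + 1/(qz)\<close>, that is, \<open>z\<close> is shifted by \<open>q\<^sup>1\<^sup>/\<^sup>2\<close> and the variable is rescaled; \<open>psi\<close> and
  \<open>shifted_chebyshev_T\<close> are \<open>\<phi>\<^sub>k\<close> (for \<open>a q\<^sup>-\<^sup>1\<^sup>/\<^sup>2\<close>) and \<open>2T\<^sub>k\<close> (up to a power of \<open>q\<close>) in that variable.
\<close>
definition psi :: "nat \<Rightarrow> 'k poly" where
  "psi k = (\<Prod>i<k. [:1 + a\<^sup>2 * q ^ (2 * i) / q, - a * q ^ i:])"

definition askey_wilson_derivative :: "'k poly \<Rightarrow> 'k poly \<Rightarrow> bool" where
  "askey_wilson_derivative F f \<longleftrightarrow> (\<forall>z. z \<noteq> 0 \<longrightarrow>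
    poly F (z + 1 / (q * z)) - poly F (1 / z + z / q) = (z - 1 / z) * poly f ((z + 1 / z) / 2))"

lemma psi_degree: "psi k \<noteq> 0 \<and> degree (psi k) = k"
proof (induction k)
  case 0
  show ?case by (simp add: psi_def)
next
  case (Suc k)
  define l where "l = [:1 + a\<^sup>2 * q ^ (2 * k) / q, - a * q ^ k:]"
  have "l \<noteq> 0" "degree l = 1" using a0 q0 by (simp_all add: l_def)
  moreover have "psi (Suc k) = psi k * l" by (simp only: psi_def prod.lessThan_Suc l_def)
  ultimately show ?case using Suc by (simp add: degree_mult_eq)
qed

text \<open>The defining equation fixes \<open>f\<close> at \<open>(z + 1/z)/2\<close> whenever
  \<open>z^2 \<noteq> 1\<close>. Powers of \<open>q\<close> give infinitely many such points, as
  \<open>z\<close> and \<open>w\<close> share a point only if \<open>z = w\<close> or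
  \<open>zw = 1\<close>.\<close>

lemma askey_wilson_derivative_unique:
  assumes "askey_wilson_derivative F f" "askey_wilson_derivative F f'"
  shows "f = f'"
proof (rule ccontr)
  assume "f \<noteq> f'"
  then have fin: "finite {x. poly (f - f') x = 0}"
    by (intro poly_roots_finite) simp
  define x where "x n = (q ^ Suc n + 1 / q ^ Suc n) / 2" for n
  have "x n \<in> {x. poly (f - f') x = 0}" for n
  proof -
    define z where "z = q ^ Suc n"
    have z: "z \<noteq> 0" using q0 by (simp add: z_def)
    have "(z - 1 / z) * poly f (x n) = (z - 1 / z) * poly f' (x n)"
      using assms z unfolding askey_wilson_derivative_def x_def z_def[symmetric] by metis
    moreover have "z - 1 / z \<noteq> 0"
    proof
      assume "z - 1 / z = 0"
      then have "q ^ (Suc n + Suc n) = 1" using z by (simp add: z_def power_add field_simps)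
      then show False using qpow[of "Suc n + Suc n"] by simp
    qed
    ultimately show ?thesis by simp
  qed
  moreover have "inj x"
  proof (rule linorder_injI)
    fix i j :: nat assume ij: "i < j"
    show "x i \<noteq> x j"
    proof
      assume eq: "x i = x j"
      define z w where "z = q ^ Suc i" and "w = q ^ Suc j"
      have zw: "z \<noteq> 0" "w \<noteq> 0" using q0 by (simp_all add: z_def w_def)
      have "z + 1 / z = w + 1 / w" using eq two unfolding x_def z_def w_def divide_cancel_right by blast
      then have "w + w * (z * z) = z + w * (w * z)"
        using zw by (simp add: field_simps)
      moreover have "(z - w) * (z * w - 1) = w + w * (z * z) - (z + w * (w * z))"
        by (simp add: algebra_simps)
      ultimately have "(z - w) * (z * w - 1) = 0" by simp
      moreover have "z * w \<noteq> 1" using qpow[of "Suc i + Suc j"] by (simp add: z_def w_def power_add mult_ac)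
      ultimately have "z = w" by simp
      moreover have "w = z * q ^ (j - i)" using ij unfolding z_def w_def by (simp flip: power_add)
      ultimately show False using qpow[of "j - i"] ij zw by simp
    qed
  qed
  ultimately show False
    using fin by (metis finite_subset image_subsetI infinite_UNIV_nat finite_imageD inj_on_def)
qed

section \<open>Derivatives of the product basis\<close>

lemma poly_phi:
  assumes "z \<noteq> 0"
  shows "poly (phi k) ((z + 1 / z) / 2) = qpoch (a * z) k * qpoch (a / z) k"
proof -
  have "1 + a\<^sup>2 * q ^ (2 * i) - (z + 1 / z) * (a * q ^ i) = (1 - a * z * q ^ i) * (1 - a / z * q ^ i)" for i
    using assms unfolding power_even_eq by (simp add: field_simps power2_eq_square)
  then show ?thesis
    using two by (simp add: phi_def poly_prod qpoch_def flip: prod.distrib)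
qed

lemma poly_psi:
  assumes "z \<noteq> 0"
  shows "poly (psi k) (z + 1 / (q * z)) = qpoch (a * z) k * qpoch (a / (q * z)) k"
proof -
  have "1 + a\<^sup>2 * q ^ (2 * i) / q - (z + 1 / (q * z)) * (a * q ^ i) =
    (1 - a * z * q ^ i) * (1 - a / (q * z) * q ^ i)" for i
    using assms q0 unfolding power_even_eq by (simp add: field_simps power2_eq_square)
  then show ?thesis
    using two by (simp add: psi_def poly_prod qpoch_def flip: prod.distrib)
qed

lemma qpoch_shift: "qpoch (x / q) (Suc k) = (1 - x / q) * qpoch x k"
  using q0 by (induction k) (simp_all add: qpoch_Suc)

text \<open>Both evaluations, related by \<open>z\<close> to \<open>1/z\<close>, share
  \<open>(az, a/z; q)_k\<close>; the difference of the leftover factors is divisible by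
  \<open>z - 1/z\<close>.\<close>

lemma askey_wilson_derivative_psi: "askey_wilson_derivative (psi (Suc k)) (smult (a / q * (1 - q ^ Suc k)) (phi k))"
  unfolding askey_wilson_derivative_def
proof (intro allI impI)
  fix z :: 'k assume z: "z \<noteq> 0"
  define K where "K = q ^ k"
  have sh: "qpoch (a / (q * y)) (Suc k) = (1 - a / (q * y)) * qpoch (a / y) k" for y
    using qpoch_shift[of "a / y" k] by (simp add: mult.commute)
  have 1: "poly (psi (Suc k)) (z + 1 / (q * z)) =
      qpoch (a * z) k * qpoch (a / z) k * ((1 - a * z * K) * (1 - a / (q * z)))"
    unfolding poly_psi[OF z] sh by (simp add: qpoch_Suc K_def)
  have "poly (psi (Suc k)) (1 / z + 1 / (q * (1 / z))) =
      qpoch (a * z) k * qpoch (a / z) k * ((1 - a / z * K) * (1 - a * z / q))"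
    using poly_psi[of "1 / z" "Suc k"] z unfolding sh by (simp add: qpoch_Suc K_def)
  then have 2: "poly (psi (Suc k)) (1 / z + z / q) =
      qpoch (a * z) k * qpoch (a / z) k * ((1 - a / z * K) * (1 - a * z / q))" by simp
  have "(1 - a * z * K) * (1 - a / (q * z)) - (1 - a / z * K) * (1 - a * z / q) =
      (z - 1 / z) * (a / q * (1 - q * K))"
    using z q0 by (simp add: divide_simps) (simp add: algebra_simps power2_eq_square)
  then show "poly (psi (Suc k)) (z + 1 / (q * z)) - poly (psi (Suc k)) (1 / z + z / q) =
      (z - 1 / z) * poly (smult (a / q * (1 - q ^ Suc k)) (phi k)) ((z + 1 / z) / 2)"
    unfolding 1 2 by (simp add: poly_phi[OF z] K_def[symmetric] flip: right_diff_distrib)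
qed

text \<open>Forced by \<open>F = psi 1\<close>, which is 0 at the point of \<open>z = a/q\<close>
  and \<open>(1 - ab/q) (1 - a/b)\<close> at that of \<open>z = b/q\<close>.\<close>

definition kappa :: 'k where "kappa = a / q * (1 - q) / ((1 - a * b / q) * (1 - a / b))"

text \<open>By linearity and uniqueness of the derivative, one derivative with the right value for
  each \<open>psi k\<close> suffices. There only the value at \<open>z = b/q\<close> remains, and it
  carries the Pochhammer symbols of \<open>phi_moment\<close>.\<close>

lemma functional_askey_wilson_derivative:
  assumes L: "poly_functional L" and Lphi: "\<And>k. L (phi k) = phi_moment k" and "askey_wilson_derivative F f"
  shows "L f = kappa * (poly F (b / q + 1 / b) - poly F (a / q + 1 / a))"
proof -
  interpret L: poly_functional L by fact
  have "\<exists>f. askey_wilson_derivative F f \<and> L f = kappa * (poly F (b / q + 1 / b) - poly F (a / q + 1 / a))"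
    using psi_degree
  proof (induction F rule: degree_basis_induct)
    case zero
    show ?case by (intro exI[of _ 0]) (simp add: askey_wilson_derivative_def L.zero)
  next
    case (basis n)
    show ?case
    proof (cases n)
      case 0
      then show ?thesis by (intro exI[of _ 0]) (simp add: askey_wilson_derivative_def L.zero psi_def)
    next
      case (Suc k)
      \<comment> \<open>At \<open>z = a/q\<close> the second symbol is
        \<open>(1; q)_(k+1) = 0\<close>.\<close>
      have pa: "poly (psi (Suc k)) (a / q + 1 / a) = 0"
        using poly_psi[of "a / q" "Suc k"] a0 q0 qpoch_shift[of q k] by simp
      have ea: "a / (q * (b / q)) = a / b" "q * (b / q) = b" using q0 by simp_all
      have "qpoch (a / b) (Suc k) = (1 - a / b) * qpoch (a * q / b) k"
        using qpoch_shift[of "a * q / b" k] q0 by simp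
      moreover have "qpoch (a * b / q) (Suc k) = (1 - a * b / q) * qpoch (a * b) k"
        by (rule qpoch_shift)
      ultimately have pb: "poly (psi (Suc k)) (b / q + 1 / b) =
          (1 - a * b / q) * (1 - a / b) * (qpoch (a * b) k * qpoch (a * q / b) k)"
        using poly_psi[of "b / q" "Suc k"] b0 q0 unfolding ea by simp
      have nz: "1 - a * b / q \<noteq> 0" "1 - a / b \<noteq> 0" "1 - q ^ Suc k \<noteq> 0"
        using ab aqb[of 0] b0 q0 one_minus_qpow[of "Suc k"] by auto
      have cancel: "c * D * (x * y * r / D) = c * r / (u * w) * (u * w * (x * y) - 0)"
        if "D \<noteq> 0" "u \<noteq> 0" "w \<noteq> 0" for c D x y r u w :: 'k
        using that by simp
      have "L (smult (a / q * (1 - q ^ Suc k)) (phi k)) =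
          kappa * (poly (psi (Suc k)) (b / q + 1 / b) - poly (psi (Suc k)) (a / q + 1 / a))"
        unfolding L.smult Lphi phi_moment_def pa pb kappa_def by (rule cancel) (use nz in blast)+
      then show ?thesis unfolding Suc using askey_wilson_derivative_psi by blast
    qed
  next
    case (add F G)
    then obtain f g where "askey_wilson_derivative F f" "askey_wilson_derivative G g"
      and h: "L f = kappa * (poly F (b / q + 1 / b) - poly F (a / q + 1 / a))"
      "L g = kappa * (poly G (b / q + 1 / b) - poly G (a / q + 1 / a))" by blast
    then have "askey_wilson_derivative (F + G) (f + g)" unfolding askey_wilson_derivative_def by (simp add: algebra_simps)
    moreover have "L (f + g) = kappa * (poly (F + G) (b / q + 1 / b) - poly (F + G) (a / q + 1 / a))"
      unfolding L.add h by (simp add: algebra_simps)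
    ultimately show ?case by blast
  next
    case (smult c F)
    then obtain f where "askey_wilson_derivative F f \<and> L f = kappa * (poly F (b / q + 1 / b) - poly F (a / q + 1 / a))"
      by blast
    then show ?case
      by (intro exI[of _ "smult c f"]) (auto simp: askey_wilson_derivative_def L.smult mult.left_commute simp flip: right_diff_distrib)
  qed
  then show ?thesis using askey_wilson_derivative_unique[OF assms(3)] by auto
qed

text \<open>This is \<open>sin t U_n(cos t) = sin((n+1)t)\<close> with
  \<open>z = exp(it)\<close>.\<close>

lemma poly_chebyshev_U:
  fixes z :: 'k
  assumes "z \<noteq> 0"
  shows "(z - 1 / z) * poly (chebyshev_U n) ((z + 1 / z) / 2) = z ^ Suc n - 1 / z ^ Suc n"
proof (induction n rule: chebyshev_U.induct)
  case 1
  show ?case by simp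
next
  case 2
  show ?case using assms two by (simp add: field_simps power2_eq_square)
next
  case (3 n)
  have p1: "poly [:0, 2:] (y / 2) = y" for y :: 'k using two by simp
  have "(z - 1 / z) * poly (chebyshev_U (Suc (Suc n))) ((z + 1 / z) / 2) =
    (z + 1 / z) * (z ^ Suc (Suc n) - 1 / z ^ Suc (Suc n)) - (z ^ Suc n - 1 / z ^ Suc n)"
    unfolding 3[symmetric] chebyshev_U.simps poly_diff poly_mult p1 by (simp only: algebra_simps)
  also have "\<dots> = z ^ Suc (Suc (Suc n)) - 1 / z ^ Suc (Suc (Suc n))"
    using assms by (simp add: field_simps)
  finally show ?case .
qed

fun shifted_chebyshev_T :: "nat \<Rightarrow> 'k poly" where
  "shifted_chebyshev_T 0 = [:2:]"
| "shifted_chebyshev_T (Suc 0) = [:0, 1:]"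
| "shifted_chebyshev_T (Suc (Suc n)) = [:0, 1:] * shifted_chebyshev_T (Suc n) - smult (1 / q) (shifted_chebyshev_T n)"

lemma poly_shifted_chebyshev_T:
  assumes "z \<noteq> 0"
  shows "poly (shifted_chebyshev_T n) (z + 1 / (q * z)) = z ^ n + 1 / (q * z) ^ n"
proof (induction n rule: shifted_chebyshev_T.induct)
  case (3 n)
  have "poly (shifted_chebyshev_T (Suc (Suc n))) (z + 1 / (q * z)) =
    (z + 1 / (q * z)) * (z ^ Suc n + 1 / (q * z) ^ Suc n) - 1 / q * (z ^ n + 1 / (q * z) ^ n)"
    unfolding 3[symmetric] by simp
  also have "\<dots> = z ^ Suc (Suc n) + 1 / (q * z) ^ Suc (Suc n)"
    using assms q0 by (simp add: field_simps)
  finally show ?case .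
qed simp_all

text \<open>Exchanging \<open>z\<close> and \<open>1/z\<close> in
  \<open>z^(n+1) + 1/(qz)^(n+1)\<close> and subtracting leaves a multiple of
  \<open>z^(n+1) - 1/z^(n+1)\<close>.\<close>

lemma askey_wilson_derivative_chebyshev: "askey_wilson_derivative (shifted_chebyshev_T (Suc n)) (smult (1 - 1 / q ^ Suc n) (chebyshev_U n))"
  unfolding askey_wilson_derivative_def
proof (intro allI impI)
  fix z :: 'k assume z: "z \<noteq> 0"
  have "poly (shifted_chebyshev_T (Suc n)) (1 / z + z / q) = (1 / z) ^ Suc n + 1 / (q * (1 / z)) ^ Suc n"
    using poly_shifted_chebyshev_T[of "1 / z" "Suc n"] z by simp
  then have "poly (shifted_chebyshev_T (Suc n)) (z + 1 / (q * z)) - poly (shifted_chebyshev_T (Suc n)) (1 / z + z / q) =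
     (1 - 1 / q ^ Suc n) * (z ^ Suc n - 1 / z ^ Suc n)"
    unfolding poly_shifted_chebyshev_T[OF z] using z q0 by (simp add: field_simps)
  then show "poly (shifted_chebyshev_T (Suc n)) (z + 1 / (q * z)) - poly (shifted_chebyshev_T (Suc n)) (1 / z + z / q) =
      (z - 1 / z) * poly (smult (1 - 1 / q ^ Suc n) (chebyshev_U n)) ((z + 1 / z) / 2)"
    unfolding poly_chebyshev_U[OF z, symmetric] by simp
qed

end

section \<open>Powers in the basis of Chebyshev polynomials\<close>

text \<open>For \<open>k \<ge> 0\<close> this counts the paths of \<open>n\<close> steps up or down
  from 0 to \<open>k\<close> that stay nonnegative. An integer \<open>k\<close> lets the recursion
  refer to \<open>-1\<close>.\<close>

definition ballot :: "nat \<Rightarrow> int \<Rightarrow> int" where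
  "ballot n k = binom n ((of_nat n - of_int k) / 2) - binom n ((of_nat n - of_int k) / 2 - 1)"

section \<open>Binomial coefficients and ballot numbers\<close>

lemma binom_Ints:
  "binom n (of_int i) = (if 0 \<le> i \<and> i \<le> int n then int (n choose nat i) else 0)"
proof -
  have "(of_int i :: rat) \<le> of_nat n \<longleftrightarrow> i \<le> int n"
    by (metis of_int_le_iff of_int_of_nat_eq)
  then show ?thesis by (simp add: binom_def)
qed

lemma binom_Suc: "binom (Suc n) r = binom n r + binom n (r - 1)"
proof (cases "r \<in> \<int>")
  case True
  then obtain i where r: "r = of_int i" by (auto elim: Ints_cases)
  have r1: "r - 1 = of_int (i - 1)" by (simp add: r)
  show ?thesis
  proof (cases "i \<le> 0")
    case True
    then show ?thesis unfolding r1 unfolding r binom_Ints by auto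
  next
    case False
    then obtain m where i: "i = int (Suc m)"
      by (metis gr0_implies_Suc linorder_not_le zero_less_imp_eq_int)
    have e: "int (Suc m) - 1 = int m" by simp
    then show ?thesis unfolding r1 unfolding r binom_Ints i
      by (auto simp: e binomial_eq_0 not_le simp del: of_nat_Suc)
  qed
next
  case False
  then have "r - 1 \<notin> \<int>" by (metis Ints_1 Ints_add diff_add_cancel)
  with False show ?thesis by (simp add: binom_def)
qed

lemma binom_symmetric: "binom n (of_nat n - r) = binom n r"
proof (cases "r \<in> \<int>")
  case True
  then obtain i where r: "r = of_int i" by (auto elim: Ints_cases)
  have r1: "of_nat n - r = of_int (int n - i)" by (simp add: r)
  show ?thesis
    unfolding r1 unfolding r binom_Ints
    by (auto simp: nat_diff_distrib binomial_symmetric[of "nat i" n, symmetric])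
next
  case False
  then have "of_nat n - r \<notin> \<int>" by (metis Ints_diff Ints_of_nat diff_diff_eq2 add_diff_cancel_left')
  with False show ?thesis by (simp add: binom_def)
qed

lemma ballot_Suc: "ballot (Suc n) k = ballot n (k - 1) + ballot n (k + 1)"
proof -
  have e: "(of_nat (Suc n) - of_int k) / 2 = (of_nat n - of_int (k - 1)) / (2::rat)"
    "(of_nat n - of_int (k - 1)) / 2 - 1 = (of_nat n - of_int (k + 1)) / (2::rat)"
    by (simp_all add: field_simps)
  show ?thesis unfolding ballot_def binom_Suc e by simp
qed

text \<open>The lower indices \<open>(n+1)/2\<close> and \<open>(n-1)/2\<close> are mirror
  images.\<close>

lemma ballot_minus_1: "ballot n (- 1) = 0"
proof -
  have "(of_nat n - of_int (- 1)) / 2 - 1 = of_nat n - (of_nat n - of_int (- 1)) / (2::rat)"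
    by (simp add: field_simps)
  then show ?thesis unfolding ballot_def by (simp only: binom_symmetric)
qed

lemma ballot_eq_0: "k > int n \<Longrightarrow> ballot n k = 0"
  by (simp add: ballot_def binom_def)

lemma ballot_0: "ballot 0 0 = 1"
  by (simp add: ballot_def binom_def)

text \<open>Both lower indices are at most \<open>n/2\<close>, where binomial coefficients
  increase.\<close>

lemma ballot_nonneg: "ballot n (int k) \<ge> 0"
proof (cases "(of_nat n - of_nat k) / (2::rat) \<in> \<int>")
  case True
  then obtain i where r: "(of_nat n - of_nat k) / (2::rat) = of_int i" by (auto elim: Ints_cases)
  then have "of_nat n - of_nat k = (of_int (2 * i) :: rat)" by simp
  then have "int n - int k = 2 * i" by (metis of_int_eq_iff of_int_diff of_int_of_nat_eq)
  then have i: "2 * i \<le> int n" by simp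
  have r1: "(of_nat n - of_nat k) / (2::rat) - 1 = of_int (i - 1)" by (simp add: r)
  have "n choose nat (i - 1) \<le> n choose nat i" if "i \<ge> 1"
    using i that by (intro binomial_mono) auto
  then show ?thesis unfolding ballot_def of_int_of_nat_eq r1 unfolding r binom_Ints using i by auto
next
  case False
  then have "(of_nat n - of_nat k) / (2::rat) - 1 \<notin> \<int>" by (metis Ints_1 Ints_add diff_add_cancel)
  with False show ?thesis by (simp add: ballot_def binom_def)
qed

text \<open>Multiplication by \<open>2x\<close> sends \<open>U_k\<close> to
  \<open>U_(k+1) + U_(k-1)\<close>, the pattern of \<open>ballot_Suc\<close>.\<close>

lemma power_chebyshev_U:
  "[:0, 2:] ^ n = (\<Sum>k\<le>n. smult (of_int (ballot n (int k))) (chebyshev_U k :: 'k::field poly))"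
proof (induction n)
  case 0
  show ?case by (simp add: ballot_0)
next
  case (Suc n)
  let ?c = "\<lambda>n k. of_int (ballot n k) :: 'k"
  \<comment> \<open>Shifted by one, so that \<open>U 0\<close> stands for
    \<open>U_(-1) = 0\<close>.\<close>
  define U where "U k = (if k = 0 then 0 else chebyshev_U (k - 1) :: 'k poly)" for k
  have U: "[:0, 2:] * chebyshev_U k = U (Suc (Suc k)) + U k" for k
    by (cases k) (auto simp: U_def)
  have "[:0, 2:] ^ Suc n = (\<Sum>k\<le>n. smult (?c n (int k)) (U (Suc (Suc k)))) + (\<Sum>k\<le>n. smult (?c n (int k)) (U k))"
    unfolding power_Suc Suc sum_distrib_left mult_smult_right U by (simp add: smult_add_right sum.distrib)
  \<comment> \<open>The new bottom term has coefficient \<open>ballot n (-1) = 0\<close>; the top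
    terms added next have index above \<open>n\<close>.\<close>
  also have "(\<Sum>k\<le>n. smult (?c n (int k)) (U (Suc (Suc k)))) = (\<Sum>k\<le>Suc n. smult (?c n (int k - 1)) (U (Suc k)))"
    unfolding sum.atMost_Suc_shift by (simp add: ballot_minus_1)
  also have "(\<Sum>k\<le>n. smult (?c n (int k)) (U k)) = (\<Sum>k\<le>Suc (Suc n). smult (?c n (int k)) (U k))"
    by (simp add: ballot_eq_0)
  also have "\<dots> = (\<Sum>k\<le>Suc n. smult (?c n (int k + 1)) (U (Suc k)))"
    unfolding sum.atMost_Suc_shift[of _ "Suc n"] by (simp add: U_def add.commute)
  also have "(\<Sum>k\<le>Suc n. smult (?c n (int k - 1)) (U (Suc k))) + \<dots> = (\<Sum>k\<le>Suc n. smult (?c (Suc n) (int k)) (U (Suc k)))"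
    unfolding sum.distrib[symmetric] smult_add_left[symmetric] ballot_Suc by simp
  finally show ?case by (simp add: U_def)
qed

section \<open>The moments\<close>

definition lattice_points :: "nat \<Rightarrow> (int \<times> int) set" where
  "lattice_points k = {(A, B). \<bar>A\<bar> + \<bar>B\<bar> \<le> int k \<and> [A + B = int k] (mod 2)}"

text \<open>The diamond is a product of two intervals in the coordinates \<open>A + B\<close> and \<open>A - B\<close>.\<close>
lemma bij_betw_lattice_points:
  "bij_betw (\<lambda>(i, j). (int k - int i - int j, int j - int i)) ({..k} \<times> {..k}) (lattice_points k)"
proof (rule bij_betw_imageI)
  show "inj_on (\<lambda>(i, j). (int k - int i - int j, int j - int i)) ({..k} \<times> {..k})"
    by (auto simp: inj_on_def)
  show "(\<lambda>(i, j). (int k - int i - int j, int j - int i)) ` ({..k} \<times> {..k}) = lattice_points k"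
  proof safe
    fix i j assume "i \<le> k" "j \<le> k"
    then show "(int k - int i - int j, int j - int i) \<in> lattice_points k"
      by (auto simp: lattice_points_def cong_def abs_if) presburger+
  next
    fix A B assume AB: "(A, B) \<in> lattice_points k"
    \<comment> \<open>\<open>m\<close> is the coordinate \<open>i\<close>, and \<open>j\<close> will
      be \<open>m + B\<close>.\<close>
    then obtain m where m: "int k - A - B = 2 * m"
      by (auto simp: lattice_points_def cong_iff_dvd_diff dvd_def) (metis diff_diff_eq mult_minus_right minus_diff_eq)
    have ge: "0 \<le> m" "m \<le> int k" "0 \<le> m + B" "m + B \<le> int k"
      using AB m by (auto simp: lattice_points_def)
    then show "(A, B) \<in> (\<lambda>(i, j). (int k - int i - int j, int j - int i)) ` ({..k} \<times> {..k})"
      using m by (intro image_eqI[of _ _ "(nat m, nat (m + B))"]) auto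
  qed
qed

lemma finite_lattice_points: "finite (lattice_points k)"
  using bij_betw_finite[OF bij_betw_lattice_points] by simp

context aw_generic begin

text \<open>Resolves the definite description: the functional with values \<open>phi_moment\<close>
  meets its conditions, and the \<open>P n\<close> contain one polynomial of each degree, which
  gives uniqueness.\<close>

lemma aw_functional_phi:
  shows "poly_functional (aw_functional a b (q / a) (q / b) q)"
    and "aw_functional a b (q / a) (q / b) q (phi k) = phi_moment k"
proof -
  obtain L where L: "poly_functional L" and Lphi: "\<And>k. L (phi k) = phi_moment k"
    using functional_exists[of phi phi_moment] phi_degree by metis
  interpret L: poly_functional L by fact
  have L1: "L 1 = 1" using Lphi[of 0] qpow[of 1] by (simp add: phi_moment_def)
  have LP: "L (P n) = 0" if "n \<ge> 1" for n
  proof -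
    have "L (aw_phi n) = (\<Sum>k\<le>n. aw_coeff n k * phi_moment k)" unfolding aw_phi_def L.sum L.smult Lphi ..
    also have "\<dots> = 0" using that by (intro sum_aw_coeff_phi_moment) simp
    finally show ?thesis unfolding P_eq_aw_phi[THEN conjunct1] L.smult by simp
  qed
  have "L' = L" if L': "Vector_Spaces.linear smult (*) L'" "L' 1 = 1" "\<forall>n\<ge>1. L' (P n) = 0" for L'
  proof (rule functional_unique[OF aw_poly_degree])
    show "poly_functional L'" using L'(1) by (simp add: linear_functional_iff poly_functional_def)
    show "L' (P n) = L (P n)" for n
    proof (cases "n = 0")
      case True
      then show ?thesis using L'(2) L1 by simp
    next
      case False
      then have "n \<ge> 1" by simp
      then show ?thesis using L'(3) LP by metis
    qed
  qed (fact L)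
  moreover have "Vector_Spaces.linear smult (*) L"
    by (simp add: linear_functional_iff L.add L.smult)
  ultimately have "aw_functional a b (q / a) (q / b) q = L"
    unfolding aw_functional_def using L1 LP by (intro the_equality) blast+
  then show "poly_functional (aw_functional a b (q / a) (q / b) q)"
    and "aw_functional a b (q / a) (q / b) q (phi k) = phi_moment k"
    using L Lphi by simp_all
qed

text \<open>In the coordinates \<open>i\<close>, \<open>j\<close> the term is
  \<open>a^k (q/(ab))^i (b/a)^j\<close>, and both ratios differ from 1.\<close>

lemma sum_lattice_points:
  "(\<Sum>(A, B)\<in>lattice_points k. a powi A * b powi B * q powi ((int k - A - B) div 2)) =
   a ^ k * ((1 - (q / (a * b)) ^ Suc k) / (1 - q / (a * b))) * ((1 - (b / a) ^ Suc k) / (1 - b / a))"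
proof -
  have "(\<Sum>(A, B)\<in>lattice_points k. a powi A * b powi B * q powi ((int k - A - B) div 2)) =
    (\<Sum>(i, j)\<in>{..k} \<times> {..k}. a ^ k * (q / (a * b)) ^ i * (b / a) ^ j)"
  proof (rule sum.reindex_bij_betw[OF bij_betw_lattice_points, symmetric, THEN trans], rule sum.cong)
    fix x assume "x \<in> {..k} \<times> {..k}"
    obtain i j where x: "x = (i, j)" by force
    have "(int k - (int k - int i - int j) - (int j - int i)) div 2 = int i" by simp
    moreover have "a powi (int k - int i - int j) = a ^ k / a ^ i / a ^ j"
      "b powi (int j - int i) = b ^ j / b ^ i"
      using a0 b0 by (simp_all add: power_int_diff)
    ultimately show "(\<lambda>(A, B). a powi A * b powi B * q powi ((int k - A - B) div 2))
        ((\<lambda>(i, j). (int k - int i - int j, int j - int i)) x) =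
      (\<lambda>(i, j). a ^ k * (q / (a * b)) ^ i * (b / a) ^ j) x"
      by (simp only: x prod.case) (simp add: power_divide power_mult_distrib mult_ac)
  qed simp
  also have "\<dots> = a ^ k * ((\<Sum>i\<le>k. (q / (a * b)) ^ i) * (\<Sum>j\<le>k. (b / a) ^ j))"
    unfolding sum_product unfolding sum.cartesian_product unfolding sum_distrib_left
    by (intro sum.cong) (auto simp: mult.assoc)
  finally show ?thesis using ab aqb[of 0] a0 b0 by (simp add: sum_gp0 mult_ac)
qed

text \<open>The derivative rule gives a difference of two values of
  \<open>shifted_chebyshev_T\<close>, which factors like the closed form in
  \<open>sum_lattice_points\<close>.\<close>

lemma aw_functional_chebyshev_U:
  "aw_functional a b (q / a) (q / b) q (chebyshev_U k) =
   1 / q_number q (Suc k) *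
   (\<Sum>(A, B)\<in>lattice_points k. a powi A * b powi B * q powi ((int k - A - B) div 2))"
proof -
  interpret L: poly_functional "aw_functional a b (q / a) (q / b) q" by (rule aw_functional_phi)
  define x y Q where "x = a ^ Suc k" and "y = b ^ Suc k" and "Q = q ^ Suc k"
  have nz: "x \<noteq> 0" "y \<noteq> 0" "Q \<noteq> 0" "Q - 1 \<noteq> 0" "1 - q \<noteq> 0" "a * b - q \<noteq> 0" "a - b \<noteq> 0"
    using a0 b0 q0 qpow[of "Suc k"] qpow[of 1] ab aqb[of 0] by (auto simp: x_def y_def Q_def)
  let ?L = "aw_functional a b (q / a) (q / b) q (chebyshev_U k)"
  have g: "poly (shifted_chebyshev_T (Suc k)) (w / q + 1 / w) = w ^ Suc k / Q + 1 / w ^ Suc k" if "w \<noteq> 0" for w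
    using poly_shifted_chebyshev_T[of "w / q" "Suc k"] that q0 by (simp add: power_divide Q_def)
  have "(1 - 1 / Q) * ?L = kappa * (y / Q + 1 / y - (x / Q + 1 / x))"
    using functional_askey_wilson_derivative[OF aw_functional_phi askey_wilson_derivative_chebyshev] g[OF a0] g[OF b0]
    by (simp add: L.smult x_def y_def Q_def)
  then have "?L = Q / (Q - 1) * (kappa * (y / Q + 1 / y - (x / Q + 1 / x)))"
    using nz by (simp add: field_simps)
  also have "kappa = a * b * (1 - q) / ((q - a * b) * (b - a))"
    unfolding kappa_def using nz q0 b0 by (simp add: divide_simps)
  also have "y / Q + 1 / y - (x / Q + 1 / x) = (x * y - Q) * (y - x) / (Q * x * y)"
    using nz by (simp add: divide_simps) (simp add: algebra_simps)
  finally have l: "?L = a * b * (1 - q) * ((x * y - Q) * (y - x)) / ((Q - 1) * (q - a * b) * (b - a) * (x * y))"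
    using nz by (simp add: mult.assoc)
  have e: "a ^ k = x / a" "(q / (a * b)) ^ Suc k = Q / (x * y)" "(b / a) ^ Suc k = y / x"
    using a0 by (simp_all add: x_def y_def Q_def power_divide power_mult_distrib)
  have f: "1 - Q / (x * y) = (x * y - Q) / (x * y)" "1 - q / (a * b) = (a * b - q) / (a * b)"
    "1 - y / x = (x - y) / x" "1 - b / a = (a - b) / a"
    using nz a0 b0 by (simp_all add: field_simps)
  show ?thesis
    unfolding sum_lattice_points l e f q_number_def Q_def[symmetric]
    using nz a0 b0 by (simp add: divide_simps) (rule disjI2, simp add: algebra_simps)
qed

theorem moment_formula:
  "2 ^ n * aw_moment a b (q / a) (q / b) q n =
   (\<Sum>k=0..n. of_int (ballot n (int k)) * (1 / q_number q (k + 1)) *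
     (\<Sum>(A, B)\<in>lattice_points k. a powi A * b powi B * q powi ((int k - A - B) div 2)))"
proof -
  interpret L: poly_functional "aw_functional a b (q / a) (q / b) q" by (rule aw_functional_phi)
  have "[:0, 2:] ^ n = smult (2 ^ n) (monom 1 n :: 'k poly)"
    using monom_power[of "2::'k" 1 n] by (simp add: monom_altdef smult_monom)
  then have "2 ^ n * aw_moment a b (q / a) (q / b) q n = aw_functional a b (q / a) (q / b) q ([:0, 2:] ^ n)"
    by (simp add: aw_moment_def L.smult)
  then show ?thesis
    unfolding power_chebyshev_U by (simp add: L.sum L.smult aw_functional_chebyshev_U atLeast0AtMost)
qed

end

section \<open>Positivity\<close>

definition nonneg_coeffs :: "int poly \<Rightarrow> bool" where
  "nonneg_coeffs p \<longleftrightarrow> (\<forall>i. 0 \<le> coeff p i)"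

lemma nonneg_coeffs_intros:
  "nonneg_coeffs 0" "nonneg_coeffs 1" "0 \<le> c \<Longrightarrow> nonneg_coeffs (monom c i)"
  "nonneg_coeffs p \<Longrightarrow> nonneg_coeffs r \<Longrightarrow> nonneg_coeffs (p + r)"
  "nonneg_coeffs p \<Longrightarrow> nonneg_coeffs r \<Longrightarrow> nonneg_coeffs (p * r)"
  by (auto simp: nonneg_coeffs_def coeff_mult intro!: sum_nonneg)

lemma nonneg_coeffs_sum: "(\<And>i. i \<in> I \<Longrightarrow> nonneg_coeffs (f i)) \<Longrightarrow> nonneg_coeffs (\<Sum>i\<in>I. f i)"
  by (induction I rule: infinite_finite_induct) (auto intro: nonneg_coeffs_intros)

lemma nonneg_coeffs_prod: "(\<And>i. i \<in> I \<Longrightarrow> nonneg_coeffs (f i)) \<Longrightarrow> nonneg_coeffs (\<Prod>i\<in>I. f i)"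
  by (induction I rule: infinite_finite_induct) (auto intro: nonneg_coeffs_intros)

section \<open>Polynomials in \<open>q\<close> inside the field of rational functions\<close>

definition q_embed :: "int poly \<Rightarrow> ratfun" where "q_embed p = to_fract [:[:p:]:]"

lemma q_embed_simps:
  "q_embed 0 = 0" "q_embed 1 = 1" "q_embed (p + r) = q_embed p + q_embed r"
  "q_embed (p * r) = q_embed p * q_embed r"
  by (simp_all add: q_embed_def flip: one_pCons to_fract_add to_fract_mult)

lemma q_embed_sum: "q_embed (\<Sum>i\<in>I. f i) = (\<Sum>i\<in>I. q_embed (f i))"
  by (induction I rule: infinite_finite_induct) (simp_all add: q_embed_simps)

lemma q_embed_prod: "q_embed (\<Prod>i\<in>I. f i) = (\<Prod>i\<in>I. q_embed (f i))"
  by (induction I rule: infinite_finite_induct) (simp_all add: q_embed_simps)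

lemma q_embed_power: "q_embed (p ^ n) = q_embed p ^ n"
  by (induction n) (simp_all add: q_embed_simps)

lemma q_embed_of_int: "q_embed (of_int c) = of_int c"
proof -
  have n: "q_embed (of_nat m) = of_nat m" for m
    by (induction m) (simp_all add: q_embed_simps)
  \<comment> \<open>Reduces to natural numbers through
    \<open>c + max 0 (-c) = max 0 c\<close>.\<close>
  have "q_embed (of_int c) + q_embed (of_nat (nat (- c))) = q_embed (of_nat (nat c))"
    unfolding q_embed_simps(3)[symmetric] by (rule arg_cong[of _ _ q_embed]) (cases "c \<ge> 0"; simp)
  then show ?thesis unfolding n by (cases "c \<ge> 0") (simp_all add: add_eq_0_iff)
qed

lemma q_embed_var: "q_embed (monom 1 i) = var_q ^ i"
proof -
  have "monom 1 i = (monom 1 1 :: int poly) ^ i" by (simp add: monom_power)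
  moreover have "q_embed (monom 1 1) = var_q" by (simp add: q_embed_def var_q_def monom_altdef)
  ultimately show ?thesis by (simp only: q_embed_power)
qed

section \<open>The indeterminates are generic\<close>

lemma var_eq_to_fract:
  "var_a * var_b * var_q ^ n = to_fract ([:0, 1:] * [:[:0, 1:]:] * [:[:[:0, 1:]:]:] ^ n)"
  "var_a * var_q ^ n = to_fract ([:0, 1:] * [:[:[:0, 1:]:]:] ^ n)"
  "var_q ^ n = to_fract ([:[:[:0, 1:]:]:] ^ n)"
proof -
  have p: "to_fract x ^ n = to_fract (x ^ n)" for x :: "int poly poly poly"
    by (induction n) (simp_all add: to_fract_mult)
  show "var_a * var_b * var_q ^ n = to_fract ([:0, 1:] * [:[:0, 1:]:] * [:[:[:0, 1:]:]:] ^ n)"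
    "var_a * var_q ^ n = to_fract ([:0, 1:] * [:[:[:0, 1:]:]:] ^ n)"
    "var_q ^ n = to_fract ([:[:[:0, 1:]:]:] ^ n)"
    unfolding var_a_def var_b_def var_q_def p by (simp_all only: to_fract_mult)
qed

text \<open>Evaluation at \<open>a = 0\<close>, as \<open>a\<close> is the outermost
  variable.\<close>

lemma to_fract_neq: "poly x 0 \<noteq> poly y 0 \<Longrightarrow> to_fract x \<noteq> to_fract y"
  by auto

interpretation vars: aw_generic var_a var_b var_q
proof
  show "(2::ratfun) \<noteq> 0" by simp
  show "var_a \<noteq> 0" "var_b \<noteq> 0" "var_q \<noteq> 0"
    by (simp_all add: var_a_def var_b_def var_q_def)
  show "var_q ^ n \<noteq> 1" if "n > 0" for n
  proof -
    have "poly (poly (poly ([:[:[:0, 1:]:]:] ^ n) 0) 0) 0 = (0::int)"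
      using that by (simp add: poly_power)
    then have "[:[:[:0, 1:]:]:] ^ n \<noteq> (1 :: int poly poly poly)" by force
    then show ?thesis unfolding var_eq_to_fract(3) by (metis to_fract_1 to_fract_eq_iff)
  qed
  show "var_a * var_b * var_q ^ n \<noteq> 1" for n
    unfolding var_eq_to_fract(1) to_fract_1[symmetric] by (rule to_fract_neq) simp
  show "var_a * var_q ^ n \<noteq> var_b" for n
    unfolding var_eq_to_fract(2) var_b_def by (rule to_fract_neq) simp
  show "var_a * var_b \<noteq> var_q"
    using var_eq_to_fract(1)[of 0] unfolding var_q_def by (simp del: to_fract_mult)
qed

lemma q_number_var: "q_number var_q m = q_embed (\<Sum>i<m. monom 1 i)"
  using vars.qpow[of 1] by (simp add: q_number_def q_embed_sum q_embed_var sum_gp_strict)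

section \<open>Closure properties of positive Laurent polynomials\<close>

lemma positive_laurent_monomial:
  assumes "nonneg_coeffs p"
  shows "positive_laurent (q_embed p * var_a powi A * var_b powi B)"
  unfolding positive_laurent_def
  by (intro exI[of _ "{(A, B)}"] exI[of _ "\<lambda>_ _. p"])
    (use assms in \<open>auto simp: nonneg_coeffs_def q_embed_def\<close>)

lemma positive_laurent_add:
  assumes "positive_laurent x" "positive_laurent y"
  shows "positive_laurent (x + y)"
proof -
  obtain S p where S: "finite S" "\<And>A B. nonneg_coeffs (p A B)"
    "x = (\<Sum>(A, B)\<in>S. q_embed (p A B) * var_a powi A * var_b powi B)"
    using assms(1) unfolding positive_laurent_def nonneg_coeffs_def q_embed_def by blast
  obtain T r where T: "finite T" "\<And>A B. nonneg_coeffs (r A B)"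
    "y = (\<Sum>(A, B)\<in>T. q_embed (r A B) * var_a powi A * var_b powi B)"
    using assms(2) unfolding positive_laurent_def nonneg_coeffs_def q_embed_def by blast
  \<comment> \<open>Each family is cut off to its own index set, outside which it must not
    contribute.\<close>
  define w where "w A B = (if (A, B) \<in> S then p A B else 0) + (if (A, B) \<in> T then r A B else 0)" for A B
  have "x = (\<Sum>(A, B)\<in>S \<union> T. q_embed (if (A, B) \<in> S then p A B else 0) * var_a powi A * var_b powi B)"
    unfolding S(3) using S(1) T(1)
    by (intro sum.mono_neutral_cong_left) (auto simp: q_embed_simps)
  moreover have "y = (\<Sum>(A, B)\<in>S \<union> T. q_embed (if (A, B) \<in> T then r A B else 0) * var_a powi A * var_b powi B)"
    unfolding T(3) using S(1) T(1)
    by (intro sum.mono_neutral_cong_left) (auto simp: q_embed_simps)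
  ultimately have "x + y = (\<Sum>(A, B)\<in>S \<union> T. q_embed (w A B) * var_a powi A * var_b powi B)"
    by (simp only: sum.distrib[symmetric])
      (auto simp only: w_def q_embed_simps distrib_right intro!: sum.cong)
  moreover have "nonneg_coeffs (w A B)" for A B
    unfolding w_def using S(2) T(2) by (auto intro: nonneg_coeffs_intros)
  ultimately show ?thesis
    unfolding positive_laurent_def using S(1) T(1)
    by (intro exI[of _ "S \<union> T"] exI[of _ w]) (simp add: nonneg_coeffs_def q_embed_def)
qed

lemma positive_laurent_sum:
  "(\<And>i. i \<in> I \<Longrightarrow> positive_laurent (f i)) \<Longrightarrow> positive_laurent (\<Sum>i\<in>I. f i)"
proof (induction I rule: infinite_finite_induct)
  case empty
  show ?case using positive_laurent_monomial[of 0] by (simp add: q_embed_simps nonneg_coeffs_intros)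
next
  case (infinite I)
  show ?case using infinite(1) positive_laurent_monomial[of 0] by (simp add: q_embed_simps nonneg_coeffs_intros)
qed (auto intro: positive_laurent_add)

text \<open>\<open>[k+1]_q\<close> is one of the factors of \<open>[n+1]_q!\<close>, and each of the
  others is a polynomial \<open>1 + q + ... + q^(i-1)\<close>.\<close>

lemma q_fact_div_q_number:
  assumes "k \<le> n"
  obtains p where "nonneg_coeffs p" "q_fact var_q (n + 1) * (1 / q_number var_q (k + 1)) = q_embed p"
proof
  let ?p = "\<Prod>i\<in>{1..n + 1} - {k + 1}. \<Sum>j<i. monom 1 j :: int poly"
  show "nonneg_coeffs ?p"
    by (intro nonneg_coeffs_prod nonneg_coeffs_sum nonneg_coeffs_intros) simp
  have "q_number var_q (k + 1) \<noteq> 0"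
    using vars.qpow[of "k + 1"] vars.qpow[of 1] by (simp add: q_number_def)
  then show "q_fact var_q (n + 1) * (1 / q_number var_q (k + 1)) = q_embed ?p"
    unfolding q_fact_def q_embed_prod q_number_var[symmetric] using assms
    by (subst prod.remove[of _ "k + 1"]) auto
qed

lemma positive_laurent_term:
  assumes "k \<le> n" "0 \<le> c"
  shows "positive_laurent (q_fact var_q (n + 1) * (of_int c * (1 / q_number var_q (k + 1)) *
     (\<Sum>(A, B)\<in>lattice_points k. var_a powi A * var_b powi B * var_q powi ((int k - A - B) div 2))))"
proof -
  obtain p where p: "nonneg_coeffs p" "q_fact var_q (n + 1) * (1 / q_number var_q (k + 1)) = q_embed p"
    using q_fact_div_q_number[OF assms(1)] .
  define e where "e A B = nat ((int k - A - B) div 2)" for A B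
  have "q_fact var_q (n + 1) * (of_int c * (1 / q_number var_q (k + 1)) * x) =
      q_embed (of_int c * p) * x" for x
    unfolding q_embed_simps p(2)[symmetric] q_embed_of_int by (simp only: mult_ac)
  moreover have "q_embed (of_int c * p) *
      (\<Sum>(A, B)\<in>lattice_points k. var_a powi A * var_b powi B * var_q powi ((int k - A - B) div 2)) =
    (\<Sum>(A, B)\<in>lattice_points k. q_embed (of_int c * p * monom 1 (e A B)) * var_a powi A * var_b powi B)"
    unfolding sum_distrib_left
  proof (intro sum.cong refl, clarify)
    fix A B assume "(A, B) \<in> lattice_points k"
    \<comment> \<open>Since \<open>A + B \<le> k\<close>, only nonnegative powers of
      \<open>q\<close> occur.\<close>
    then have "0 \<le> (int k - A - B) div 2" by (auto simp: lattice_points_def)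
    then have "var_q powi ((int k - A - B) div 2) = q_embed (monom 1 (e A B))"
      unfolding q_embed_var e_def by (simp add: power_int_def)
    then show "q_embed (of_int c * p) * (var_a powi A * var_b powi B * var_q powi ((int k - A - B) div 2)) =
      q_embed (of_int c * p * monom 1 (e A B)) * var_a powi A * var_b powi B"
      by (simp only: q_embed_simps mult_ac)
  qed
  moreover have "nonneg_coeffs (of_int c * p * monom 1 i)" for i
    using assms(2) p(1) nonneg_coeffs_intros(3)[of c 0]
    by (intro nonneg_coeffs_intros) (simp_all add: monom_0 of_int_poly)
  ultimately show ?thesis
    by (simp only:) (auto intro!: positive_laurent_sum positive_laurent_monomial)
qed

theorem corollary5p9:
  fixes n :: nat
  shows "2^n * aw_moment var_a var_b (var_q / var_a) (var_q / var_b) var_q n =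
           (\<Sum>k=0..n.
              of_int (binom n ((of_nat n - of_nat k) / 2) - binom n ((of_nat n - of_nat k) / 2 - 1))
              * (1 / q_number var_q (k + 1))
              * (\<Sum>(A, B) \<in> {(A :: int, B :: int).
                     \<bar>A\<bar> + \<bar>B\<bar> \<le> int k \<and> [A + B = int k] (mod 2)}.
                   var_a powi A * var_b powi B * var_q powi ((int k - A - B) div 2)))
         \<and> positive_laurent
             (q_fact var_q (n + 1) * 2^n
              * aw_moment var_a var_b (var_q / var_a) (var_q / var_b) var_q n)"
proof
  note f = vars.moment_formula[of n]
  show "2^n * aw_moment var_a var_b (var_q / var_a) (var_q / var_b) var_q n =
           (\<Sum>k=0..n.
              of_int (binom n ((of_nat n - of_nat k) / 2) - binom n ((of_nat n - of_nat k) / 2 - 1))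
              * (1 / q_number var_q (k + 1))
              * (\<Sum>(A, B) \<in> {(A :: int, B :: int).
                     \<bar>A\<bar> + \<bar>B\<bar> \<le> int k \<and> [A + B = int k] (mod 2)}.
                   var_a powi A * var_b powi B * var_q powi ((int k - A - B) div 2)))"
    using f unfolding ballot_def lattice_points_def of_int_of_nat_eq .
  show "positive_laurent
             (q_fact var_q (n + 1) * 2^n
              * aw_moment var_a var_b (var_q / var_a) (var_q / var_b) var_q n)"
    unfolding mult.assoc[of _ "2 ^ n"] f
    by (subst sum_distrib_left, intro positive_laurent_sum positive_laurent_term ballot_nonneg) simp
qed

end
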